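(* Let $(X,\|\cdot\|,\Omega)$ be a semi-dispersing Minkowski billiard. Then any maximal forward billiard trajectory having a starting point either has infinite length or is a finite polygonal chain ending at a non-smooth point of the boundary $\partial\Omega$.
   Context: "Smooth" means $C^1$ throughout. Minkowski norm. A Minkowski space is a finite-dimensional real vector space $X$ with a Minkowski norm, i.e. a continuous function $\|\cdot\|\colon X\to\mathbb{R}$ such that: (i) $\|x\|>0$ for all $x\ne 0$; (ii) $\|tx\|=t\|x\|$ for all $x\in X$, $t\ge 0$; (iii) $\|x+y\|\le\|x\|+\|y\|$; (iv) strict convexity: the unit sphere $\{x:\|x\|=1\}$ contains no (nondegenerate) line segment; (v) $\|\cdot\|$ is $C^1$ on $X\setminus\{0\}$. The norm is not assumed symmetric: in general $\|x\|\ne\|-x\|$. Minkowski billiard. It is given by a Minkowski space $(X,\|\cdot\|)$ and a domain $\Omega\subset X$ (the billiard table), with closure $\overline{\Omega}$ and boundary $\partial\Omega$. A point $p\in\partial\Omega$ is smooth if in a neighborhood of $p$ the set $\partial\Omega$ is a smooth ($C^1$) hypersurface, and non-smooth otherwise. Trajectory. A billiard trajectory is a continuous curve $\gamma\colon I\to\overline{\Omega}$, with $I\subset\mathbb{R}$ an interval, such that for every interior point $t\in I$ there is $\delta>0$ such that for all $t_1\in(t-\delta,t)$ and $t_2\in(t,t+\delta)$ at least one of the following holds: (1) $\gamma|_{[t_1,t_2]}$ parametrizes a segment of an affine line in $X$ with unit speed ($\|\dot\gamma\|=1$); (2) $p=\gamma(t)$ is a smooth point of $\partial\Omega$, the restrictions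 $\gamma|_{[t_1,t]}$ and $\gamma|_{[t,t_2]}$ are unit-speed parametrizations of the segments $[q_1,p]$ and $[p,q_2]$, where $q_1=\gamma(t_1)$, $q_2=\gamma(t_2)$, and $p$ is a critical point of the function $x\mapsto\|x-q_1\|+\|q_2-x\|$, $x\in\partial\Omega$. No condition is imposed at endpoints of $I$. The length of $\gamma$ is the length of the interval $I$. Semi-dispersing. The billiard is semi-dispersing if $\Omega=X\setminus\bigcup_{i=1}^m W_i$, where $W_1,\dots,W_m\subset X$ (the walls) are closed convex sets with nonempty interiors and smooth boundaries. Maximal forward trajectory. A trajectory has a starting point if its parameter interval $I$ contains its left endpoint; it is a maximal forward trajectory if it cannot be extended forward in time, i.e. it is not the restriction of a billiard trajectory defined on a strictly larger interval with the same left endpoint. (Its domain is then, after a shift of time, $[0,+\infty)$ or $[0,T]$ with $T<\infty$; in the latter case the trajectory ends at $\gamma(T)$.) *)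

theory Defs
  imports "HOL-Analysis.Analysis"
begin

section \<open>Minkowski norms\<close>

definition C1_on :: "('a::real_normed_vector \<Rightarrow> real) \<Rightarrow> 'a set \<Rightarrow> bool" where
  "C1_on f U \<longleftrightarrow> (\<exists>f' :: 'a \<Rightarrow> ('a \<Rightarrow>\<^sub>L real).
      (\<forall>x\<in>U. (f has_derivative blinfun_apply (f' x)) (at x)) \<and> continuous_on U f')"

text \<open>
  The norm need not be symmetric, so homogeneity is only required for nonnegative factors. The
  Euclidean structure of the type serves as the standard topology of a finite-dimensional
  space (of dimension at least 1) and plays no other role.
\<close>

definition minkowski_norm :: "('a::euclidean_space \<Rightarrow> real) \<Rightarrow> bool" where
  "minkowski_norm N \<longleftrightarrow>
      continuous_on UNIV N \<and>
      (\<forall>x. x \<noteq> 0 \<longrightarrow> N x > 0) \<and>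
      (\<forall>x t. t \<ge> 0 \<longrightarrow> N (t *\<^sub>R x) = t * N x) \<and>
      (\<forall>x y. N (x + y) \<le> N x + N y) \<and>
      (\<forall>a b. a \<noteq> b \<longrightarrow> \<not> closed_segment a b \<subseteq> {x. N x = 1}) \<and>
      C1_on N (- {0})"

section \<open>Hypersurfaces, tangent vectors, critical points\<close>

text \<open>
  Near \<open>p\<close>, the set \<open>S\<close> is an embedded \<open>C\<^sup>1\<close> hypersurface: the regular zero set of a
  \<open>C\<^sup>1\<close> function.
\<close>

definition C1_hypersurface_near :: "'a::euclidean_space set \<Rightarrow> 'a \<Rightarrow> bool" where
  "C1_hypersurface_near S p \<longleftrightarrow> p \<in> S \<and>
      (\<exists>U \<phi>. \<exists>\<phi>' :: 'a \<Rightarrow> ('a \<Rightarrow>\<^sub>L real).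
         open U \<and> p \<in> U \<and>
         (\<forall>x\<in>U. (\<phi> has_derivative blinfun_apply (\<phi>' x)) (at x)) \<and>
         continuous_on U \<phi>' \<and>
         (\<forall>x\<in>U. \<phi>' x \<noteq> 0) \<and>
         S \<inter> U = {x\<in>U. \<phi> x = 0})"

definition tangent_vectors :: "'a::euclidean_space set \<Rightarrow> 'a \<Rightarrow> 'a set" where
  "tangent_vectors S p = {v. \<exists>\<epsilon>>0. \<exists>c :: real \<Rightarrow> 'a.
      c C1_differentiable_on {-\<epsilon><..<\<epsilon>} \<and> c ` {-\<epsilon><..<\<epsilon>} \<subseteq> S \<and>
      c 0 = p \<and> (c has_vector_derivative v) (at 0)}"

text \<open>
  Critical points of the restriction to \<open>S\<close> of a function \<open>f\<close> that is differentiable at \<open>p\<close> in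
  the ambient space. The notion is only applied at points near which \<open>S\<close> is a hypersurface.
\<close>

definition critical_point_on :: "'a::euclidean_space set \<Rightarrow> ('a \<Rightarrow> real) \<Rightarrow> 'a \<Rightarrow> bool" where
  "critical_point_on S f p \<longleftrightarrow> p \<in> S \<and>
      (\<exists>D. (f has_derivative D) (at p) \<and> (\<forall>v\<in>tangent_vectors S p. D v = 0))"

section \<open>Billiard tables\<close>

definition minkowski_billiard :: "('a::euclidean_space \<Rightarrow> real) \<Rightarrow> 'a set \<Rightarrow> bool" where
  "minkowski_billiard N \<Omega> \<longleftrightarrow> minkowski_norm N \<and> open \<Omega> \<and> connected \<Omega> \<and> \<Omega> \<noteq> {}"

definition smooth_boundary_point :: "'a::euclidean_space set \<Rightarrow> 'a \<Rightarrow> bool" where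
  "smooth_boundary_point \<Omega> p \<longleftrightarrow> p \<in> frontier \<Omega> \<and> C1_hypersurface_near (frontier \<Omega>) p"

definition wall :: "'a::euclidean_space set \<Rightarrow> bool" where
  "wall W \<longleftrightarrow> closed W \<and> convex W \<and> interior W \<noteq> {} \<and>
      (\<forall>p\<in>frontier W. C1_hypersurface_near (frontier W) p)"

definition semi_dispersing :: "'a::euclidean_space set \<Rightarrow> bool" where
  "semi_dispersing \<Omega> \<longleftrightarrow>
      (\<exists>(m::nat) W. (\<forall>i\<in>{1..m}. wall (W i)) \<and> \<Omega> = UNIV - (\<Union>i\<in>{1..m}. W i))"

section \<open>Trajectories\<close>

definition unit_speed_segment ::
    "('a::euclidean_space \<Rightarrow> real) \<Rightarrow> (real \<Rightarrow> 'a) \<Rightarrow> real \<Rightarrow> real \<Rightarrow> bool" where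
  "unit_speed_segment N \<gamma> s t \<longleftrightarrow>
      (\<exists>v. N v = 1 \<and> (\<forall>u\<in>{s..t}. \<gamma> u = \<gamma> s + (u - s) *\<^sub>R v))"

definition bounces_at ::
    "('a::euclidean_space \<Rightarrow> real) \<Rightarrow> 'a set \<Rightarrow> (real \<Rightarrow> 'a) \<Rightarrow> real \<Rightarrow> real \<Rightarrow> real \<Rightarrow> bool" where
  "bounces_at N \<Omega> \<gamma> t1 t t2 \<longleftrightarrow>
      smooth_boundary_point \<Omega> (\<gamma> t) \<and>
      unit_speed_segment N \<gamma> t1 t \<and> unit_speed_segment N \<gamma> t t2 \<and>
      critical_point_on (frontier \<Omega>) (\<lambda>x. N (x - \<gamma> t1) + N (\<gamma> t2 - x)) (\<gamma> t)"

text \<open>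
  A curve on an interval \<open>I\<close> is a total function of which only the values on \<open>I\<close> matter. Since
  \<open>t\<close> is interior to \<open>I\<close>, the inclusion of the \<open>\<delta>\<close>-neighbourhood in \<open>I\<close> is no restriction;
  it keeps \<open>t1\<close> and \<open>t2\<close> inside the domain of the curve.
\<close>

definition billiard_trajectory ::
    "('a::euclidean_space \<Rightarrow> real) \<Rightarrow> 'a set \<Rightarrow> real set \<Rightarrow> (real \<Rightarrow> 'a) \<Rightarrow> bool" where
  "billiard_trajectory N \<Omega> I \<gamma> \<longleftrightarrow>
      is_interval I \<and> I \<noteq> {} \<and> continuous_on I \<gamma> \<and> \<gamma> ` I \<subseteq> closure \<Omega> \<and>
      (\<forall>t\<in>interior I. \<exists>\<delta>>0. {t - \<delta><..<t + \<delta>} \<subseteq> I \<and>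
         (\<forall>t1\<in>{t - \<delta><..<t}. \<forall>t2\<in>{t<..<t + \<delta>}.
            unit_speed_segment N \<gamma> t1 t2 \<or> bounces_at N \<Omega> \<gamma> t1 t t2))"

definition trajectory_length :: "real set \<Rightarrow> ennreal" where
  "trajectory_length I = emeasure lborel I"

definition left_endpoint_in :: "real \<Rightarrow> real set \<Rightarrow> bool" where
  "left_endpoint_in a I \<longleftrightarrow> a \<in> I \<and> (\<forall>t\<in>I. a \<le> t)"

definition maximal_forward_trajectory ::
    "('a::euclidean_space \<Rightarrow> real) \<Rightarrow> 'a set \<Rightarrow> real \<Rightarrow> real set \<Rightarrow> (real \<Rightarrow> 'a) \<Rightarrow> bool" where
  "maximal_forward_trajectory N \<Omega> a I \<gamma> \<longleftrightarrow>
      billiard_trajectory N \<Omega> I \<gamma> \<and> left_endpoint_in a I \<and>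
      \<not> (\<exists>J \<eta>. billiard_trajectory N \<Omega> J \<eta> \<and> left_endpoint_in a J \<and> I \<subset> J \<and>
              (\<forall>t\<in>I. \<eta> t = \<gamma> t))"

text \<open>
  The breakpoints are \<open>\<tau> 0 < \<dots> < \<tau> k\<close>; \<open>k = 0\<close> occurs exactly when \<open>a = b\<close>, i.e.\ for a
  trajectory defined at a single instant.
\<close>

definition finite_polygonal_chain ::
    "('a::euclidean_space \<Rightarrow> real) \<Rightarrow> (real \<Rightarrow> 'a) \<Rightarrow> real \<Rightarrow> real \<Rightarrow> bool" where
  "finite_polygonal_chain N \<gamma> a b \<longleftrightarrow>
      (\<exists>(k::nat) \<tau>. \<tau> 0 = a \<and> \<tau> k = b \<and>
         (\<forall>i<k. \<tau> i < \<tau> (Suc i) \<and> unit_speed_segment N \<gamma> (\<tau> i) (\<tau> (Suc i))))"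

end

theory Submission
  imports Defs
begin

text \<open>
  The heart of the matter is that bounces cannot accumulate in finite time. Suppose the trajectory
  tends to a point \<open>q\<close> at time \<open>b\<close>. There are finitely many walls, and they are closed; so shortly before
  \<open>b\<close> the trajectory touches only walls that contain \<open>q\<close> (\<open>walls_near\<close>). Consider the quantity
  \<open>u + dN (\<gamma>' u) (q - \<gamma> u)\<close>, where \<open>dN\<close> is the differential of the norm. By homogeneity of \<open>N\<close> it is
  constant along free segments. At a bounce, the reflection law says that \<open>dN (\<gamma>')\<close> jumps by a
  multiple of the conormal of the boundary; convexity of the norm gives its sign, and convexity of
  the walls says that \<open>q\<close> lies behind the tangent hyperplane, so the quantity can only decrease
  (\<open>momentum_jump\<close>, \<open>arrival_bound_antimono\<close>). Comparing its values at time \<open>u\<close> and in the limit \<open>b\<close> gives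
  \<open>b - u \<le> N (q - \<gamma> u)\<close>. The trajectory has unit speed, so it realizes the distance to \<open>q\<close>, and strict
  convexity makes it a straight segment near time \<open>b\<close> (\<open>straight_into_common_point\<close>). The same
  monotonicity treats the starting time, where bounces might also accumulate
  (\<open>straight_from_common_point\<close>). Between the two ends, compactness of the time interval leaves finitely
  many segments.

  It remains to see that a maximal trajectory of finite length cannot stop elsewhere. A half-open
  time interval can be closed, because the trajectory is Lipschitz (\<open>extend_to_closed_interval\<close>). At a
  point of the table the last segment can be prolonged. At a smooth boundary point all walls passing
  through it lie behind one common tangent hyperplane (\<open>tangent_half_space\<close>); a particle coming from
  the table either moves tangentially and goes on straight, or it is reflected into the open
  half-space of directions entering the table. The reflected direction is found by minimizing
  \<open>N - dN v\<close>, with \<open>v\<close> the velocity of arrival, on an affine hyperplane (\<open>reflected_direction\<close>).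
\<close>

section \<open>Minkowski norms and their differentials\<close>

locale minkowski_space =
  fixes N :: "'a::euclidean_space \<Rightarrow> real" and dN :: "'a \<Rightarrow> 'a \<Rightarrow> real"
  assumes norm: "minkowski_norm N"
    and deriv: "x \<noteq> 0 \<Longrightarrow> (N has_derivative dN x) (at x)"
begin

lemma pos: "x \<noteq> 0 \<Longrightarrow> N x > 0"
  and homogeneous: "t \<ge> 0 \<Longrightarrow> N (t *\<^sub>R x) = t * N x"
  and triangle: "N (x + y) \<le> N x + N y"
  and continuous: "continuous_on UNIV N"
  using norm unfolding minkowski_norm_def by auto

lemma zero [simp]: "N 0 = 0"
  using homogeneous[of 0 0] by simp

lemma linear_dN: "x \<noteq> 0 \<Longrightarrow> linear (dN x)"
  using deriv has_derivative_linear by blast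

lemma directional_derivative: "x \<noteq> 0 \<Longrightarrow> ((\<lambda>t. N (x + t *\<^sub>R y)) has_real_derivative dN x y) (at 0)"
proof -
  assume x: "x \<noteq> 0"
  have "((\<lambda>t. x + t *\<^sub>R y) has_derivative (\<lambda>t. t *\<^sub>R y)) (at (0::real))"
    by (auto intro!: derivative_eq_intros)
  from diff_chain_at[OF this, of N "dN x"] deriv[OF x]
  have "((\<lambda>t. N (x + t *\<^sub>R y)) has_derivative (\<lambda>t. dN x (t *\<^sub>R y))) (at 0)"
    by (simp add: o_def)
  then show ?thesis
    by (simp add: has_field_derivative_def linear_scale[OF linear_dN[OF x]] mult.commute[of _ "dN x y"])
qed

lemma dN_self: assumes "x \<noteq> 0" shows "dN x x = N x"
proof -
  have "((\<lambda>t. (1 + t) * N x) has_real_derivative N x) (at 0)"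
    by (auto intro!: derivative_eq_intros)
  then have "((\<lambda>t. N (x + t *\<^sub>R x)) has_real_derivative N x) (at 0)"
  proof (rule has_field_derivative_transform_within[where d=1])
    fix t :: real assume "dist t 0 < 1"
    then have "1 + t \<ge> 0" by (simp add: dist_real_def abs_less_iff)
    from homogeneous[OF this, of x] show "(1 + t) * N x = N (x + t *\<^sub>R x)"
      by (simp add: scaleR_add_left)
  qed simp_all
  with directional_derivative[OF assms, of x] show ?thesis
    by (rule DERIV_unique)
qed

lemma dN_le: assumes "x \<noteq> 0" shows "dN x y \<le> N y"
proof (rule ccontr)
  assume "\<not> dN x y \<le> N y"
  then have "dN x y - N y > 0" by simp
  moreover have "((\<lambda>t. N (x + t *\<^sub>R y) - t * N y) has_real_derivative dN x y - N y) (at 0)"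
    using directional_derivative[OF assms, of y] by (auto intro!: derivative_eq_intros)
  ultimately obtain d where d: "d > 0" "\<And>h. h > 0 \<Longrightarrow> h < d \<Longrightarrow> N x < N (x + h *\<^sub>R y) - h * N y"
    using DERIV_pos_inc_right[of "\<lambda>t. N (x + t *\<^sub>R y) - t * N y" "dN x y - N y" 0] by auto
  have "N x < N (x + (d/2) *\<^sub>R y) - (d/2) * N y" using d(1) by (intro d(2)) auto
  also have "N (x + (d/2) *\<^sub>R y) \<le> N x + (d/2) * N y"
    using triangle[of x "(d/2) *\<^sub>R y"] homogeneous[of "d/2" y] d(1) by simp
  finally show False by simp
qed

lemma dN_ge: "x \<noteq> 0 \<Longrightarrow> - N (- y) \<le> dN x y"
  using dN_le[of x "- y"] linear_neg[OF linear_dN, of x y] by simp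

lemma dN_scale: assumes "x \<noteq> 0" "t > 0" shows "dN (t *\<^sub>R x) = dN x"
proof
  fix y
  have 1: "((\<lambda>s. N (t *\<^sub>R x + s *\<^sub>R (t *\<^sub>R y))) has_real_derivative dN (t *\<^sub>R x) (t *\<^sub>R y)) (at 0)"
    using assms by (intro directional_derivative) auto
  have "N (t *\<^sub>R x + s *\<^sub>R (t *\<^sub>R y)) = t * N (x + s *\<^sub>R y)" for s
    using homogeneous[of t "x + s *\<^sub>R y"] assms by (simp add: algebra_simps)
  moreover have "((\<lambda>s. t * N (x + s *\<^sub>R y)) has_real_derivative t * dN x y) (at 0)"
    using directional_derivative[OF assms(1), of y] by (auto intro!: derivative_eq_intros)
  ultimately have "dN (t *\<^sub>R x) (t *\<^sub>R y) = t * dN x y"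
    using 1 DERIV_unique by simp
  moreover have "dN (t *\<^sub>R x) (t *\<^sub>R y) = t * dN (t *\<^sub>R x) y"
    using assms by (simp add: linear_scale linear_dN)
  ultimately show "dN (t *\<^sub>R x) y = dN x y" using assms by simp
qed

text \<open>
  Strict convexity in its infinitesimal form: if the supporting functional of the unit ball at \<open>x\<close>
  also attained its maximum at a different unit vector \<open>y\<close>, it would be \<open>1\<close> on the whole segment
  between them, which would therefore lie in the unit sphere.
\<close>

lemma dN_eq_unit:
  assumes "N x = 1" "N y = 1" "dN x y = 1"
  shows "y = x"
proof (rule ccontr)
  assume ne: "y \<noteq> x"
  have x: "x \<noteq> 0" using assms by auto
  have "closed_segment x y \<subseteq> {x. N x = 1}"
  proof
    fix z assume "z \<in> closed_segment x y"
    then obtain u where u: "0 \<le> u" "u \<le> 1" "z = (1 - u) *\<^sub>R x + u *\<^sub>R y"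
      by (auto simp: closed_segment_def)
    have "N z \<le> (1 - u) * N x + u * N y"
      using triangle[of "(1 - u) *\<^sub>R x" "u *\<^sub>R y"] u by (simp add: homogeneous)
    moreover have "dN x z = (1 - u) * dN x x + u * dN x y"
      using u by (simp add: linear_add[OF linear_dN[OF x]] linear_scale[OF linear_dN[OF x]])
    moreover have "dN x z \<le> N z" using dN_le[OF x] .
    ultimately show "z \<in> {x. N x = 1}" using assms dN_self[OF x] by simp
  qed
  with ne norm show False unfolding minkowski_norm_def by metis
qed

lemma dN_eq:
  assumes "x \<noteq> 0" "dN x y = N y"
  shows "y = (N y / N x) *\<^sub>R x"
proof (cases "y = 0")
  case False
  have px: "N x > 0" and py: "N y > 0" using pos assms False by auto
  have "(1 / N y) *\<^sub>R y = (1 / N x) *\<^sub>R x"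
  proof (rule dN_eq_unit)
    show "N ((1 / N x) *\<^sub>R x) = 1" "N ((1 / N y) *\<^sub>R y) = 1"
      using px py by (auto simp: homogeneous)
    have "dN ((1 / N x) *\<^sub>R x) = dN x" using px assms by (intro dN_scale) auto
    then show "dN ((1 / N x) *\<^sub>R x) ((1 / N y) *\<^sub>R y) = 1"
      using assms py by (simp add: linear_scale linear_dN)
  qed
  then have "N y *\<^sub>R ((1 / N y) *\<^sub>R y) = N y *\<^sub>R ((1 / N x) *\<^sub>R x)" by simp
  then show ?thesis using py by simp
qed simp

lemma triangle_eq:
  assumes "N (x + y) = N x + N y" "x + y \<noteq> 0"
  shows "x = (N x / N (x + y)) *\<^sub>R (x + y)"
proof (rule dN_eq[OF assms(2)])
  have "dN (x + y) x + dN (x + y) y = N (x + y)"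
    using dN_self[OF assms(2)] by (simp add: linear_add linear_dN assms)
  with dN_le[OF assms(2), of x] dN_le[OF assms(2), of y] assms(1)
  show "dN (x + y) x = N x" by simp
qed

lemma unit_vector_exists: obtains v where "N v = 1"
proof -
  obtain b :: 'a where "b \<in> Basis" using nonempty_Basis by blast
  then have "N ((1 / N b) *\<^sub>R b) = 1" using pos[of b] by (simp add: homogeneous nonzero_Basis)
  then show ?thesis using that by blast
qed

lemma norm_bound:
  obtains m where "m > 0" "\<And>x. m * norm x \<le> N x"
proof -
  have "sphere (0::'a) 1 \<noteq> {}" by simp
  then obtain x0 where x0: "x0 \<in> sphere 0 1" "\<And>x. x \<in> sphere 0 1 \<Longrightarrow> N x0 \<le> N x"
    using continuous_attains_inf[OF compact_sphere _ continuous_on_subset[OF continuous]]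
    by (metis subset_UNIV)
  have "N x0 * norm x \<le> N x" for x
  proof (cases "x = 0")
    case False
    then have "N x0 \<le> N ((1 / norm x) *\<^sub>R x)" by (intro x0(2)) simp
    then show ?thesis using False by (simp add: homogeneous field_simps)
  qed simp
  moreover have "x0 \<noteq> 0" using x0(1) by auto
  then have "N x0 > 0" by (rule pos)
  ultimately show ?thesis using that by blast
qed

text \<open>
  The reflection law has a solution. The reflected direction is the point where the convex function
  \<open>N - dN v\<close> is minimal on an affine hyperplane parallel to the mirror \<open>{w. g \<bullet> w = 0}\<close>; the minimum
  exists because this function is positive on the mirror away from \<open>0\<close>, hence coercive.
\<close>

lemma reflected_direction:
  assumes v: "N v = 1" and g: "g \<bullet> v < 0"
  obtains v' where "N v' = 1" "g \<bullet> v' > 0" "\<And>w. g \<bullet> w = 0 \<Longrightarrow> dN v' w = dN v w"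
proof -
  have v0: "v \<noteq> 0" and g0: "g \<noteq> 0" using v g by auto
  note lin = linear_dN[OF v0]
  define h where "h x = N x - dN v x" for x
  have h_cont: "continuous_on S h" for S
    unfolding h_def
    by (intro continuous_intros continuous_on_subset[OF continuous] linear_continuous_on
        linear_conv_bounded_linear[THEN iffD1] lin) auto
  define M where "M = {y. norm y = 1 \<and> g \<bullet> y = 0}"
  have M: "compact M"
  proof -
    have "M = sphere 0 1 \<inter> {y. g \<bullet> y = 0}" by (auto simp: M_def)
    then show ?thesis by (simp add: compact_Int_closed closed_hyperplane)
  qed
  have h_pos: "h y > 0" if "y \<in> M" for y
  proof (rule ccontr)
    assume "\<not> h y > 0"
    with dN_le[OF v0, of y] have "dN v y = N y" by (simp add: h_def)
    from dN_eq[OF v0 this] v have y: "y = N y *\<^sub>R v" by simp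
    have "y \<noteq> 0" and "g \<bullet> y = 0" using that by (auto simp: M_def)
    then have "N y * (g \<bullet> v) = 0" using y by (metis inner_scaleR_right)
    then show False using pos[OF \<open>y \<noteq> 0\<close>] g by simp
  qed
  obtain m where m: "m > 0" "\<And>y. y \<in> M \<Longrightarrow> m \<le> h y"
  proof (cases "M = {}")
    case True then show ?thesis using that[of 1] by auto
  next
    case False
    from continuous_attains_inf[OF M False h_cont] h_pos show ?thesis using that by blast
  qed
  have h_lower: "m * norm y \<le> h y" if "g \<bullet> y = 0" for y
  proof (cases "y = 0")
    case False
    have "(1 / norm y) *\<^sub>R y \<in> M" using that False by (simp add: M_def)
    from m(2)[OF this] have "m \<le> (1 / norm y) * h y"
      by (simp add: h_def homogeneous linear_scale[OF lin] diff_divide_distrib)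
    then show ?thesis using False by (simp add: field_simps)
  qed (simp add: h_def linear_0[OF lin])
  define x0 where "x0 = (1 / (g \<bullet> g)) *\<^sub>R g"
  have x0: "g \<bullet> x0 = 1" using g0 by (simp add: x0_def)
  define C where "C = N (- x0) + dN v x0"
  have h_lower': "m * norm (x - x0) - C \<le> h x" if "g \<bullet> x = 1" for x
  proof -
    have "m * norm (x - x0) \<le> h (x - x0)"
      using that x0 by (intro h_lower) (simp add: inner_diff_right)
    also have "\<dots> \<le> h x + C"
      using triangle[of x "- x0"] by (simp add: h_def C_def linear_diff[OF lin])
    finally show ?thesis by simp
  qed
  define R where "R = (\<bar>h x0\<bar> + \<bar>C\<bar> + 1) / m"
  define K where "K = cball x0 R \<inter> {x. g \<bullet> x = 1}"
  have "R > 0" using m(1) by (simp add: R_def add_nonneg_pos)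
  then have "x0 \<in> K" using x0 by (simp add: K_def)
  moreover have "compact K" unfolding K_def by (simp add: compact_Int_closed closed_hyperplane)
  ultimately obtain w where w: "w \<in> K" "\<And>x. x \<in> K \<Longrightarrow> h w \<le> h x"
    using continuous_attains_inf[of K h] h_cont by blast
  have gw: "g \<bullet> w = 1" using w(1) by (simp add: K_def)
  have min: "h w \<le> h x" if "g \<bullet> x = 1" for x
  proof (cases "x \<in> K")
    case False
    then have "R < norm (x - x0)" using that by (simp add: K_def dist_norm norm_minus_commute)
    then have "\<bar>h x0\<bar> + \<bar>C\<bar> + 1 < m * norm (x - x0)" using m(1) by (simp add: R_def field_simps)
    then have "h x0 \<le> h x" using h_lower'[OF that] by linarith
    then show ?thesis using w(2)[OF \<open>x0 \<in> K\<close>] by linarith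
  qed (use w in auto)
  have w0: "w \<noteq> 0" using gw by auto
  have crit: "dN w y = dN v y" if y: "g \<bullet> y = 0" for y
  proof -
    have "((\<lambda>t. h (w + t *\<^sub>R y)) has_real_derivative dN w y - dN v y) (at 0)"
      unfolding h_def linear_add[OF lin] linear_scale[OF lin]
      using directional_derivative[OF w0, of y] by (auto intro!: derivative_eq_intros)
    moreover have "\<forall>t. \<bar>0 - t\<bar> < 1 \<longrightarrow> h (w + 0 *\<^sub>R y) \<le> h (w + t *\<^sub>R y)"
      using min gw y by (simp add: inner_add_right)
    ultimately have "dN w y - dN v y = 0" by (intro DERIV_local_min[where d=1]) auto
    then show ?thesis by simp
  qed
  show ?thesis
  proof (rule that)
    have pw: "N w > 0" using pos[OF w0] .
    show "N ((1 / N w) *\<^sub>R w) = 1" using pw by (simp add: homogeneous)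
    show "g \<bullet> (1 / N w) *\<^sub>R w > 0" using gw pw by simp
    show "dN ((1 / N w) *\<^sub>R w) y = dN v y" if "g \<bullet> y = 0" for y
      using crit[OF that] dN_scale[OF w0, of "1 / N w"] pw by simp
  qed
qed

end

section \<open>Open sets with smooth boundary points\<close>

text \<open>
  If \<open>G\<close> accumulates at \<open>p\<close> from the positive side of the defining function \<open>\<phi>\<close>, then the whole
  positive side belongs to \<open>G\<close> infinitesimally: translating points of \<open>G\<close> along \<open>u\<close> increases
  \<open>\<phi>\<close>, so the translates never meet the zero set of \<open>\<phi>\<close>, which is the frontier of \<open>G\<close>.
\<close>

lemma positive_side_subset:
  fixes G :: "'a::euclidean_space set" and \<phi>' :: "'a \<Rightarrow> ('a \<Rightarrow>\<^sub>L real)"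
  assumes G: "open G" and U: "open U" "p \<in> U"
    and der: "\<And>x. x \<in> U \<Longrightarrow> (\<phi> has_derivative blinfun_apply (\<phi>' x)) (at x)"
    and cont: "continuous_on U \<phi>'"
    and fr: "frontier G \<inter> U = {x \<in> U. \<phi> x = 0}" and p: "p \<in> frontier G"
    and side: "p \<in> closure {x \<in> G \<inter> U. \<phi> x > 0}" and u: "\<phi>' p u > 0"
  shows "\<exists>\<epsilon>>0. \<forall>s\<in>{0<..<\<epsilon>}. p + s *\<^sub>R u \<in> G"
proof -
  have \<phi>p: "\<phi> p = 0" using fr p U by auto
  have "continuous (at p) (\<lambda>x. \<phi>' x u)"
    using cont U by (intro continuous_intros) (auto simp: continuous_on_eq_continuous_at)
  then have "((\<lambda>x. \<phi>' x u) \<longlongrightarrow> \<phi>' p u) (nhds p)"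
    using tendsto_at_iff_tendsto_nhds[of "\<lambda>x. \<phi>' x u" p] by (simp add: continuous_within)
  then have "\<forall>\<^sub>F x in nhds p. \<phi>' x u > 0"
    using u by (rule order_tendstoD(1))
  moreover have "\<forall>\<^sub>F x in nhds p. x \<in> U" using U by (simp add: eventually_nhds_in_open)
  ultimately have "\<forall>\<^sub>F x in nhds p. \<phi>' x u > 0 \<and> x \<in> U" by eventually_elim auto
  then obtain r where r: "r > 0" "\<And>x. dist x p < r \<Longrightarrow> \<phi>' x u > 0 \<and> x \<in> U"
    unfolding eventually_nhds_metric by auto
  have incr: "\<phi> x < \<phi> (x + s *\<^sub>R u)" if "dist x p < r/2" "0 < s" "s * norm u < r/2" for x s
  proof -
    have "\<phi> (x + 0 *\<^sub>R u) < \<phi> (x + s *\<^sub>R u)"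
    proof (rule DERIV_pos_imp_increasing[OF \<open>0 < s\<close>, where f="\<lambda>t. \<phi> (x + t *\<^sub>R u)"])
      fix t assume t: "0 \<le> t" "t \<le> s"
      have "dist (x + t *\<^sub>R u) p \<le> dist x p + t * norm u"
        using norm_triangle_ineq[of "x - p" "t *\<^sub>R u"] t by (simp add: dist_norm algebra_simps)
      also have "\<dots> < r" using that t mult_right_mono[of t s "norm u"] by auto
      finally have *: "\<phi>' (x + t *\<^sub>R u) u > 0" "x + t *\<^sub>R u \<in> U" using r(2) by auto
      have "((\<lambda>t. x + t *\<^sub>R u) has_derivative (\<lambda>t. t *\<^sub>R u)) (at t)"
        by (auto intro!: derivative_eq_intros)
      from diff_chain_at[OF this der[OF *(2)]]
      have "((\<lambda>t. \<phi> (x + t *\<^sub>R u)) has_real_derivative \<phi>' (x + t *\<^sub>R u) u) (at t)"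
        by (intro has_derivative_imp_has_field_derivative) (auto simp: o_def blinfun.scaleR_right)
      with * show "\<exists>y. ((\<lambda>t. \<phi> (x + t *\<^sub>R u)) has_real_derivative y) (at t) \<and> y > 0" by blast
    qed
    then show ?thesis by simp
  qed
  have nfr: "x \<notin> frontier G" if "\<phi> x > 0" "x \<in> U" for x
    using fr that by (metis (mono_tags, lifting) IntI less_irrefl mem_Collect_eq)
  define \<epsilon> where "\<epsilon> = r / 2 / (norm u + 1)"
  have "\<epsilon> > 0" using r(1) by (simp add: \<epsilon>_def add_nonneg_pos)
  moreover have "p + s *\<^sub>R u \<in> G" if s: "s \<in> {0<..<\<epsilon>}" for s
  proof -
    have su: "s * norm u < r/2"
    proof -
      have "s * norm u \<le> s * (norm u + 1)" using s by (simp add: mult_left_mono)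
      also have "\<dots> < \<epsilon> * (norm u + 1)" using s by (intro mult_strict_right_mono) (auto simp: add_nonneg_pos)
      also have "\<dots> = r/2"
        using add_nonneg_eq_0_iff[of "norm u" 1] by (simp add: \<epsilon>_def del: divide_divide_eq_left)
      finally show ?thesis .
    qed
    have inU: "x + t *\<^sub>R u \<in> U" if "dist x p < r/2" "0 \<le> t" "t \<le> s" for x t
    proof -
      have "dist (x + t *\<^sub>R u) p \<le> dist x p + t * norm u"
        using norm_triangle_ineq[of "x - p" "t *\<^sub>R u"] that by (simp add: dist_norm algebra_simps)
      also have "\<dots> < r" using that su mult_right_mono[of t s "norm u"] by auto
      finally show ?thesis using r(2) by auto
    qed
    \<comment> \<open>A path from \<open>G\<close> to its complement would cross the frontier, where \<open>\<phi>\<close> vanishes.\<close>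
    have moved: "x + s *\<^sub>R u \<in> G" if x: "x \<in> G" "\<phi> x > 0" "dist x p < r/2" for x
    proof (rule ccontr)
      assume n: "x + s *\<^sub>R u \<notin> G"
      let ?S = "(\<lambda>t. x + t *\<^sub>R u) ` {0..s}"
      have "connected ?S" by (intro connected_continuous_image continuous_intros) auto
      moreover have "x + 0 *\<^sub>R u \<in> ?S" "x + s *\<^sub>R u \<in> ?S" using s by (intro imageI; simp)+
      ultimately have "?S \<inter> frontier G \<noteq> {}"
        using connected_Int_frontier[of ?S G] x(1) n by auto
      then obtain t where t: "0 \<le> t" "t \<le> s" "x + t *\<^sub>R u \<in> frontier G" by auto
      have "\<phi> (x + t *\<^sub>R u) > 0"
      proof (cases "t = 0")
        case False
        then have "t * norm u < r/2" using t su mult_right_mono[of t s "norm u"] by auto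
        then show ?thesis using incr[of x t] x False t by auto
      qed (use x in auto)
      then show False using nfr inU[of x t] x t by auto
    qed
    have "p + s *\<^sub>R u \<in> closure G"
      unfolding closure_approachable
    proof (intro allI impI)
      fix e :: real assume "e > 0"
      then obtain x where "x \<in> G" "\<phi> x > 0" "dist x p < min e (r/2)"
        using side r(1) unfolding closure_approachable
        by (metis (mono_tags, lifting) IntE half_gt_zero mem_Collect_eq min_less_iff_conj)
      then show "\<exists>y\<in>G. dist y (p + s *\<^sub>R u) < e" using moved[of x] by (intro bexI[of _ "x + s *\<^sub>R u"]) auto
    qed
    moreover have "\<phi> (p + s *\<^sub>R u) > 0" using incr[of p s] su s r(1) \<phi>p by auto
    then have "p + s *\<^sub>R u \<notin> frontier G" using nfr inU[of p s] s r(1) by auto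
    ultimately show ?thesis using G by (simp add: frontier_def interior_open)
  qed
  ultimately show ?thesis by blast
qed

text \<open>
  An open set may a priori lie on both sides of its frontier; then either normal direction serves.
\<close>

lemma open_side_of_hypersurface:
  fixes G :: "'a::euclidean_space set" and \<phi>' :: "'a \<Rightarrow> ('a \<Rightarrow>\<^sub>L real)"
  assumes G: "open G" and U: "open U" "p \<in> U"
    and der: "\<And>x. x \<in> U \<Longrightarrow> (\<phi> has_derivative blinfun_apply (\<phi>' x)) (at x)"
    and cont: "continuous_on U \<phi>'"
    and fr: "frontier G \<inter> U = {x \<in> U. \<phi> x = 0}" and p: "p \<in> frontier G"
  obtains \<sigma> :: real where "\<sigma> \<noteq> 0"
    "\<And>u. \<sigma> * \<phi>' p u > 0 \<Longrightarrow> \<exists>\<epsilon>>0. \<forall>s\<in>{0<..<\<epsilon>}. p + s *\<^sub>R u \<in> G"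
proof -
  have "G \<inter> frontier G = {}" using G by (simp add: frontier_def interior_open)
  then have split: "G \<inter> U = {x \<in> G \<inter> U. \<phi> x > 0} \<union> {x \<in> G \<inter> U. \<phi> x < 0}"
    using fr by force
  have "p \<in> closure G \<inter> U" using p U by (simp add: frontier_def)
  then have "p \<in> closure (G \<inter> U)"
    using open_Int_closure_subset[OF U(1), of G] by (auto simp: Int_commute)
  then consider "p \<in> closure {x \<in> G \<inter> U. \<phi> x > 0}" | "p \<in> closure {x \<in> G \<inter> U. \<phi> x < 0}"
    by (subst (asm) split) (auto simp: closure_Un)
  then show ?thesis
  proof cases
    case 1
    show ?thesis
      by (rule that[of 1]) (use positive_side_subset[OF G U der cont fr p 1] in auto)
  next
    case 2
    have "\<exists>\<epsilon>>0. \<forall>s\<in>{0<..<\<epsilon>}. p + s *\<^sub>R u \<in> G" if "- 1 * \<phi>' p u > 0" for u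
    proof (rule positive_side_subset[OF G U, where \<phi>="\<lambda>x. - \<phi> x" and \<phi>'="\<lambda>x. - \<phi>' x"])
      show "((\<lambda>x. - \<phi> x) has_derivative blinfun_apply (- \<phi>' x)) (at x)" if "x \<in> U" for x
        using has_derivative_minus[OF der[OF that]] by (simp add: uminus_blinfun.rep_eq)
      show "continuous_on U (\<lambda>x. - \<phi>' x)" using cont by (intro continuous_intros)
    qed (use fr p 2 that in \<open>auto simp: uminus_blinfun.rep_eq\<close>)
    then show ?thesis by (intro that[of "-1"]) auto
  qed
qed

text \<open>
  Every vector annihilated by the differential is tangent. The curve is the preimage of the line
  through \<open>p\<close> in direction \<open>w\<close> under the local diffeomorphism that straightens the level sets of
  \<open>\<phi>\<close> by moving points along a transversal \<open>e\<close>. Solving the rank-one system for its velocity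
  explicitly shows that the curve is \<open>C\<^sup>1\<close>.
\<close>

lemma kernel_subset_tangent_vectors:
  fixes S :: "'a::euclidean_space set" and \<phi>' :: "'a \<Rightarrow> ('a \<Rightarrow>\<^sub>L real)"
  assumes U: "open U" "p \<in> U"
    and der: "\<And>x. x \<in> U \<Longrightarrow> (\<phi> has_derivative blinfun_apply (\<phi>' x)) (at x)"
    and cont: "continuous_on U \<phi>'" and nz: "\<phi>' p \<noteq> 0"
    and S: "S \<inter> U = {x \<in> U. \<phi> x = 0}" and p: "p \<in> S"
    and w: "\<phi>' p w = 0"
  shows "w \<in> tangent_vectors S p"
proof -
  obtain e0 where "\<phi>' p e0 \<noteq> 0" using nz by (metis blinfun_eqI zero_blinfun.rep_eq)
  define e where "e = (1 / \<phi>' p e0) *\<^sub>R e0"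
  have e: "\<phi>' p e = 1" using \<open>\<phi>' p e0 \<noteq> 0\<close> by (simp add: e_def blinfun.scaleR_right)
  define U1 where "U1 = {x \<in> U. \<phi>' x e > 0}"
  have "continuous_on U (\<lambda>x. \<phi>' x e)" using cont by (intro continuous_intros)
  then have U1: "open U1"
    using continuous_open_preimage[OF _ U(1) open_greaterThan, of "\<lambda>x. \<phi>' x e" 0]
    by (simp add: U1_def Int_def vimage_def)
  define F where "F x = x + (\<phi> x - \<phi>' p (x - p)) *\<^sub>R e" for x
  define F' where "F' x = id_blinfun + (blinfun_scaleR_left e o\<^sub>L (\<phi>' x - \<phi>' p))" for x
  have F': "F' x h = h + (\<phi>' x h - \<phi>' p h) *\<^sub>R e" for x h
    by (simp add: F'_def blinfun.add_left blinfun.diff_left)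
  have derF: "(F has_derivative blinfun_apply (F' x)) (at x)" if "x \<in> U1" for x
  proof -
    have "((\<lambda>x. \<phi>' p (x - p)) has_derivative (\<lambda>h. \<phi>' p (h - 0))) (at x)"
      by (intro bounded_linear.has_derivative[OF blinfun.bounded_linear_right] derivative_intros)
    moreover have "(\<phi> has_derivative blinfun_apply (\<phi>' x)) (at x)"
      using that by (intro der) (simp add: U1_def)
    ultimately have "(F has_derivative (\<lambda>h. h + (\<phi>' x h - \<phi>' p (h - 0)) *\<^sub>R e)) (at x)"
      unfolding F_def by (intro derivative_intros)
    moreover have "(\<lambda>h. h + (\<phi>' x h - \<phi>' p (h - 0)) *\<^sub>R e) = blinfun_apply (F' x)"
      by (simp add: F' fun_eq_iff)
    ultimately show ?thesis by simp
  qed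
  have contF: "continuous_on U1 F'"
    unfolding F'_def
    by (intro continuous_intros continuous_on_subset[OF cont]) (auto simp: U1_def)
  have pU1: "p \<in> U1" using U e by (simp add: U1_def)
  have inv: "id_blinfun o\<^sub>L F' p = id_blinfun" by (rule blinfun_eqI) (simp add: F')
  obtain U' V g g' where U': "open U'" "U' \<subseteq> U1" "p \<in> U'" and V: "open V" "F p \<in> V"
    and hom: "homeomorphism U' V F g"
    and derg: "\<And>y. y \<in> V \<Longrightarrow> (g has_derivative (g' y)) (at y)"
    and g': "\<And>y. y \<in> V \<Longrightarrow> g' y = inv (blinfun_apply (F' (g y)))"
    and bij: "\<And>y. y \<in> V \<Longrightarrow> bij (blinfun_apply (F' (g y)))"
    using inverse_function_theorem[OF U1 derF contF pU1 inv] by metis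
  have \<phi>p: "\<phi> p = 0" using S p U by auto
  have Fp: "F p = p" by (simp add: F_def \<phi>p blinfun.zero_right)
  have "open ((\<lambda>s. p + s *\<^sub>R w) -` V)"
    using V(1) by (intro open_vimage continuous_intros)
  moreover have "(0::real) \<in> (\<lambda>s. p + s *\<^sub>R w) -` V" using V Fp by simp
  ultimately obtain \<epsilon> where "\<epsilon> > 0" "ball 0 \<epsilon> \<subseteq> (\<lambda>s. p + s *\<^sub>R w) -` V"
    by (meson open_contains_ball)
  then have \<epsilon>: "\<epsilon> > 0" "\<And>s. s \<in> {-\<epsilon><..<\<epsilon>} \<Longrightarrow> p + s *\<^sub>R w \<in> V"
    by (auto simp: subset_iff dist_real_def abs_less_iff)
  define c where "c s = g (p + s *\<^sub>R w)" for s
  define D where "D s = w - (\<phi>' (c s) w / \<phi>' (c s) e) *\<^sub>R e" for s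
  have c_in: "c s \<in> U1" "F (c s) = p + s *\<^sub>R w" if "s \<in> {-\<epsilon><..<\<epsilon>}" for s
    using homeomorphism_apply2[OF hom \<epsilon>(2)[OF that]] homeomorphism_image2[OF hom] \<epsilon>(2)[OF that] U'
    by (auto simp: c_def)
  have c_der: "(c has_vector_derivative D s) (at s)" if s: "s \<in> {-\<epsilon><..<\<epsilon>}" for s
  proof -
    let ?y = "p + s *\<^sub>R w"
    have "\<phi>' (c s) e > 0" using c_in(1)[OF s] by (simp add: U1_def)
    define q where "q = \<phi>' (c s) w / \<phi>' (c s) e"
    have q: "q * \<phi>' (c s) e = \<phi>' (c s) w" "D s = w - q *\<^sub>R e"
      using \<open>\<phi>' (c s) e > 0\<close> by (auto simp: q_def D_def)
    have "F' (c s) (D s) = w - q *\<^sub>R e + (\<phi>' (c s) (w - q *\<^sub>R e) - \<phi>' p (w - q *\<^sub>R e)) *\<^sub>R e"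
      by (simp only: F' q)
    then have "F' (c s) (D s) = w"
      using q(1) by (simp add: blinfun.diff_right blinfun.scaleR_right w e)
    then have D: "g' ?y w = D s"
      using g'[OF \<epsilon>(2)[OF s]] bij[OF \<epsilon>(2)[OF s]] by (simp add: c_def inv_f_eq bij_is_inj)
    have "((\<lambda>t. p + t *\<^sub>R w) has_derivative (\<lambda>t. t *\<^sub>R w)) (at s)"
      by (auto intro!: derivative_eq_intros)
    from diff_chain_at[OF this derg[OF \<epsilon>(2)[OF s]]]
    have "(c has_derivative (\<lambda>t. g' ?y (t *\<^sub>R w))) (at s)"
      by (simp add: o_def c_def[abs_def])
    moreover have "g' ?y (t *\<^sub>R w) = t *\<^sub>R D s" for t
      using D linear_scale[OF has_derivative_linear[OF derg[OF \<epsilon>(2)[OF s]]]] by simp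
    ultimately show ?thesis by (simp add: has_vector_derivative_def)
  qed
  have c_cont: "continuous_on {-\<epsilon><..<\<epsilon>} c"
    using c_der by (meson continuous_at_imp_continuous_on has_vector_derivative_continuous)
  have "continuous_on {-\<epsilon><..<\<epsilon>} (\<lambda>s. \<phi>' (c s))"
    using c_in(1) by (intro continuous_on_compose2[OF cont c_cont]) (auto simp: U1_def)
  moreover have "\<phi>' (c s) e \<noteq> 0" if "s \<in> {-\<epsilon><..<\<epsilon>}" for s
    using c_in(1)[OF that] by (simp add: U1_def)
  ultimately have "continuous_on {-\<epsilon><..<\<epsilon>} D"
    unfolding D_def by (intro continuous_intros) auto
  with c_der have "c C1_differentiable_on {-\<epsilon><..<\<epsilon>}"
    unfolding C1_differentiable_on_def by blast
  moreover have "c s \<in> S" if s: "s \<in> {-\<epsilon><..<\<epsilon>}" for s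
  proof -
    have "\<phi>' p (F (c s) - p) = \<phi> (c s)"
      by (simp add: F_def blinfun.bilinear_simps e)
    then have "\<phi> (c s) = 0" using c_in(2)[OF s] by (simp add: blinfun.scaleR_right w)
    then show ?thesis using S c_in(1)[OF s] by (auto simp: U1_def)
  qed
  moreover have c0: "c 0 = p" using homeomorphism_apply1[OF hom U'(3)] Fp by (simp add: c_def)
  moreover have "D 0 = w" using c0 w by (simp add: D_def)
  then have "(c has_vector_derivative w) (at 0)" using c_der[of 0] \<epsilon>(1) by simp
  ultimately show ?thesis unfolding tangent_vectors_def using \<epsilon>(1) by blast
qed

text \<open>
  The conormal of the frontier, oriented towards \<open>G\<close>. It will be taken both for the table and for the
  interiors of the walls.
\<close>

lemma inward_normal:
  fixes G :: "'a::euclidean_space set"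
  assumes G: "open G" and p: "C1_hypersurface_near (frontier G) p"
  obtains g where "g \<noteq> 0"
    "\<And>u. g \<bullet> u > 0 \<Longrightarrow> \<exists>\<epsilon>>0. \<forall>s\<in>{0<..<\<epsilon>}. p + s *\<^sub>R u \<in> G"
    "\<And>w. g \<bullet> w = 0 \<Longrightarrow> w \<in> tangent_vectors (frontier G) p"
proof -
  from p obtain U \<phi> and \<phi>' :: "'a \<Rightarrow> ('a \<Rightarrow>\<^sub>L real)" where pf: "p \<in> frontier G"
    and U: "open U" "p \<in> U" and der: "\<And>x. x \<in> U \<Longrightarrow> (\<phi> has_derivative blinfun_apply (\<phi>' x)) (at x)"
    and cont: "continuous_on U \<phi>'" and nz: "\<phi>' p \<noteq> 0"
    and fr: "frontier G \<inter> U = {x \<in> U. \<phi> x = 0}"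
    unfolding C1_hypersurface_near_def by blast
  obtain \<sigma> :: real where \<sigma>: "\<sigma> \<noteq> 0"
    "\<And>u. \<sigma> * \<phi>' p u > 0 \<Longrightarrow> \<exists>\<epsilon>>0. \<forall>s\<in>{0<..<\<epsilon>}. p + s *\<^sub>R u \<in> G"
    using open_side_of_hypersurface[OF G U der cont fr pf] by metis
  define g where "g = \<sigma> *\<^sub>R adjoint (blinfun_apply (\<phi>' p)) 1"
  have g: "g \<bullet> u = \<sigma> * \<phi>' p u" for u
    using adjoint_works[of "blinfun_apply (\<phi>' p)" u 1]
    by (simp add: g_def inner_commute[of _ u] bounded_linear.linear blinfun.bounded_linear_right)
  show ?thesis
  proof (rule that)
    show "g \<noteq> 0"
    proof
      assume "g = 0"
      then have "\<phi>' p u = 0" for u using g[of u] \<sigma>(1) by simp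
      then have "\<phi>' p = 0" by (intro blinfun_eqI) simp
      with nz show False ..
    qed
  qed (use g \<sigma> kernel_subset_tangent_vectors[OF U der cont nz fr pf] in auto)
qed

section \<open>Reflection at a smooth boundary point\<close>

locale semi_dispersing_table = minkowski_space N dN
  for N :: "'a::euclidean_space \<Rightarrow> real" and dN :: "'a \<Rightarrow> 'a \<Rightarrow> real" +
  fixes \<W> :: "'a set set" and \<Omega> :: "'a set"
  assumes finite_walls: "finite \<W>"
    and walls: "W \<in> \<W> \<Longrightarrow> wall W"
    and table: "\<Omega> = - \<Union>\<W>"
begin

lemma closed_wall: "W \<in> \<W> \<Longrightarrow> closed W"
  using walls by (simp add: wall_def)

lemma open_table: "open \<Omega>"
  unfolding table using finite_walls closed_wall by (intro open_Compl closed_Union) auto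

lemma frontier_in_wall: "p \<in> frontier \<Omega> \<Longrightarrow> \<exists>W\<in>\<W>. p \<in> W"
  using open_table unfolding table by (auto simp: frontier_def interior_open)

lemma closure_disjoint_interior_wall: "W \<in> \<W> \<Longrightarrow> closure \<Omega> \<inter> interior W = {}"
  using interior_subset[of W] by (subst Int_commute) (auto simp: open_Int_closure_eq_empty table)

text \<open>
  The walls that miss \<open>p\<close> form a closed set, so they stay away from \<open>p\<close>. This reduces the dynamics near
  a point to the walls through that point.
\<close>

lemma walls_near:
  obtains r where "r > 0" "\<And>x W. dist x p < r \<Longrightarrow> W \<in> \<W> \<Longrightarrow> x \<in> W \<Longrightarrow> p \<in> W"
proof -
  have "closed (\<Union>{W \<in> \<W>. p \<notin> W})"
    using finite_walls closed_wall by (intro closed_Union) auto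
  then have "open (- \<Union>{W \<in> \<W>. p \<notin> W})" by (rule open_Compl)
  moreover have "p \<in> - \<Union>{W \<in> \<W>. p \<notin> W}" by auto
  ultimately obtain r where "r > 0" "ball p r \<subseteq> - \<Union>{W \<in> \<W>. p \<notin> W}"
    by (meson open_contains_ball)
  then show ?thesis by (intro that[of r]) (auto simp: subset_iff dist_commute)
qed

text \<open>
  Several walls may pass through a smooth boundary point \<open>p\<close>, but then they are all tangent to each
  other there. A wall through \<open>p\<close> cannot reach into the open half-space of directions that enter
  the table, because it contains the segments from \<open>p\<close> to its points. Conversely, the interior
  directions of a wall and those of the table form two disjoint open half-spaces, so they are opposite;
  this makes the table a half-space to first order.
\<close>

lemma tangent_half_space:
  assumes p: "smooth_boundary_point \<Omega> p"
  obtains g where "g \<noteq> 0"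
    "\<And>W x. W \<in> \<W> \<Longrightarrow> p \<in> W \<Longrightarrow> x \<in> W \<Longrightarrow> g \<bullet> (x - p) \<le> 0"
    "\<And>v \<epsilon>. \<epsilon> > 0 \<Longrightarrow> (\<And>s. s \<in> {0<..<\<epsilon>} \<Longrightarrow> p + s *\<^sub>R v \<in> closure \<Omega>) \<Longrightarrow> g \<bullet> v \<ge> 0"
    "\<And>v. g \<bullet> v \<ge> 0 \<Longrightarrow> \<exists>\<epsilon>>0. \<forall>s\<in>{0..<\<epsilon>}. p + s *\<^sub>R v \<in> closure \<Omega>"
    "\<And>w. w \<in> tangent_vectors (frontier \<Omega>) p \<longleftrightarrow> g \<bullet> w = 0"
proof -
  have pf: "p \<in> frontier \<Omega>" and pc: "C1_hypersurface_near (frontier \<Omega>) p"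
    using p by (auto simp: smooth_boundary_point_def)
  obtain g where g0: "g \<noteq> 0"
    and enter: "\<And>u. g \<bullet> u > 0 \<Longrightarrow> \<exists>\<epsilon>>0. \<forall>s\<in>{0<..<\<epsilon>}. p + s *\<^sub>R u \<in> \<Omega>"
    and tangent: "\<And>w. g \<bullet> w = 0 \<Longrightarrow> w \<in> tangent_vectors (frontier \<Omega>) p"
    by (fact inward_normal[OF open_table pc])
  have behind: "g \<bullet> (x - p) \<le> 0" if W: "W \<in> \<W>" "p \<in> W" "x \<in> W" for W x
  proof (rule ccontr)
    assume "\<not> g \<bullet> (x - p) \<le> 0"
    then obtain \<epsilon> where \<epsilon>: "\<epsilon> > 0" "\<And>s. s \<in> {0<..<\<epsilon>} \<Longrightarrow> p + s *\<^sub>R (x - p) \<in> \<Omega>"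
      using enter[of "x - p"] by auto
    define s where "s = min (\<epsilon>/2) 1"
    have s: "s \<in> {0<..<\<epsilon>}" "0 \<le> s" "s \<le> 1" using \<epsilon>(1) by (auto simp: s_def)
    have "convex W" using walls[OF W(1)] by (simp add: wall_def)
    from convexD_alt[OF this W(2,3) s(2,3)] have "p + s *\<^sub>R (x - p) \<in> W"
      by (simp add: algebra_simps)
    then show False using \<epsilon>(2)[OF s(1)] W(1) by (auto simp: table)
  qed
  obtain W where W: "W \<in> \<W>" "p \<in> W" using frontier_in_wall[OF pf] by auto
  have wallW: "closed W" "convex W" "interior W \<noteq> {}"
    "\<And>q. q \<in> frontier W \<Longrightarrow> C1_hypersurface_near (frontier W) q"
    using walls[OF W(1)] by (auto simp: wall_def)
  have "p \<notin> interior W" using closure_disjoint_interior_wall[OF W(1)] pf by (auto simp: frontier_def)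
  then have "p \<in> frontier W" using W by (auto simp: frontier_def closure_subset[THEN subsetD])
  moreover have "frontier (interior W) = frontier W"
    using convex_closure_interior[OF wallW(2,3)] by (simp add: frontier_def)
  ultimately have hW: "C1_hypersurface_near (frontier (interior W)) p" using wallW(4) by simp
  obtain h where h0: "h \<noteq> 0"
    and into_wall: "\<And>u. h \<bullet> u > 0 \<Longrightarrow> \<exists>\<epsilon>>0. \<forall>s\<in>{0<..<\<epsilon>}. p + s *\<^sub>R u \<in> interior W"
    by (rule inward_normal[OF open_interior hW]) (rule that; assumption)
  have leaving: "g \<bullet> v \<ge> 0"
    if v: "\<epsilon> > 0" "\<And>s. s \<in> {0<..<\<epsilon>} \<Longrightarrow> p + s *\<^sub>R v \<in> closure \<Omega>" for v \<epsilon>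
  proof (rule ccontr)
    assume gv: "\<not> g \<bullet> v \<ge> 0"
    have hv: "h \<bullet> v \<le> 0"
    proof (rule ccontr)
      assume "\<not> h \<bullet> v \<le> 0"
      then obtain d where d: "d > 0" "\<And>s. s \<in> {0<..<d} \<Longrightarrow> p + s *\<^sub>R v \<in> interior W"
        using into_wall[of v] by auto
      have "min d \<epsilon> / 2 \<in> {0<..<d}" "min d \<epsilon> / 2 \<in> {0<..<\<epsilon>}" using d(1) v(1) by auto
      then show False using d(2) v(2) closure_disjoint_interior_wall[OF W(1)] by blast
    qed
    \<comment> \<open>Tilting \<open>-v\<close> slightly towards the interior of the wall yields a direction that enters both
      the table and the wall.\<close>
    define m where "m = \<bar>g \<bullet> h\<bar> + 1"
    have m: "m > 0" by (simp add: m_def add_nonneg_pos)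
    define t where "t = - (g \<bullet> v) / 2 / m"
    have t: "t > 0" using gv m by (simp add: t_def field_simps)
    have "t * \<bar>g \<bullet> h\<bar> \<le> t * m" using t by (simp add: m_def)
    also have "\<dots> = - (g \<bullet> v) / 2" using m by (simp add: t_def)
    finally have "t * \<bar>g \<bullet> h\<bar> < - (g \<bullet> v)" using gv by simp
    moreover have "- (t * \<bar>g \<bullet> h\<bar>) \<le> t * (g \<bullet> h)"
      using t abs_ge_minus_self[of "g \<bullet> h"] by (metis mult_left_mono less_imp_le minus_le_iff mult_minus_right)
    ultimately have 1: "g \<bullet> (t *\<^sub>R h - v) > 0" by (simp add: inner_diff_right)
    have "t * (h \<bullet> h) > 0" using t h0 by simp
    then have 2: "h \<bullet> (t *\<^sub>R h - v) > 0" using hv by (simp add: inner_diff_right)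
    obtain d1 where d1: "d1 > 0" "\<And>s. s \<in> {0<..<d1} \<Longrightarrow> p + s *\<^sub>R (t *\<^sub>R h - v) \<in> \<Omega>"
      using enter[OF 1] by auto
    obtain d2 where d2: "d2 > 0" "\<And>s. s \<in> {0<..<d2} \<Longrightarrow> p + s *\<^sub>R (t *\<^sub>R h - v) \<in> interior W"
      using into_wall[OF 2] by auto
    have "min d1 d2 / 2 \<in> {0<..<d1}" "min d1 d2 / 2 \<in> {0<..<d2}" using d1(1) d2(1) by auto
    then show False
      using d1(2) d2(2) closure_disjoint_interior_wall[OF W(1)] closure_subset[of \<Omega>] by blast
  qed
  obtain r where r: "r > 0" "\<And>x W. dist x p < r \<Longrightarrow> W \<in> \<W> \<Longrightarrow> x \<in> W \<Longrightarrow> p \<in> W"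
    by (fact walls_near)
  have stay: "\<exists>\<epsilon>>0. \<forall>s\<in>{0..<\<epsilon>}. p + s *\<^sub>R v \<in> closure \<Omega>" if gv: "g \<bullet> v \<ge> 0" for v
  proof -
    have "p + s *\<^sub>R v \<in> closure \<Omega>" if s: "0 \<le> s" "s * norm v < r" for s
      unfolding closure_approachable
    proof (intro allI impI)
      fix e :: real assume "e > 0"
      define d where "d = min e (r - s * norm v) / (2 * norm g)"
      have d: "d > 0" "d * norm g < e" "d * norm g < r - s * norm v"
        using \<open>e > 0\<close> s g0 by (auto simp: d_def min_def)
      let ?x = "p + s *\<^sub>R v + d *\<^sub>R g"
      have "norm (s *\<^sub>R v + d *\<^sub>R g) \<le> s * norm v + d * norm g"
        using norm_triangle_ineq[of "s *\<^sub>R v" "d *\<^sub>R g"] s d(1) by simp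
      then have x: "dist ?x p < r" using d by (simp add: dist_norm add.assoc)
      have "?x \<in> \<Omega>"
      proof (rule ccontr)
        assume "?x \<notin> \<Omega>"
        then obtain W where W: "W \<in> \<W>" "?x \<in> W" by (auto simp: table)
        from behind[OF W(1) r(2)[OF x W] W(2)] have "s * (g \<bullet> v) + d * (g \<bullet> g) \<le> 0"
          by (simp add: inner_add_right add.assoc)
        moreover have "s * (g \<bullet> v) \<ge> 0" "d * (g \<bullet> g) > 0" using s gv d g0 by auto
        ultimately show False by simp
      qed
      moreover have "dist ?x (p + s *\<^sub>R v) < e" using d by (simp add: dist_norm)
      ultimately show "\<exists>y\<in>\<Omega>. dist y (p + s *\<^sub>R v) < e" by blast
    qed
    moreover have "s * norm v < r" if "0 \<le> s" "s < r / (norm v + 1)" for s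
    proof -
      have "s * norm v \<le> s * (norm v + 1)" using that by (simp add: mult_left_mono)
      also have "\<dots> < r" using that by (simp add: pos_less_divide_eq add_nonneg_pos)
      finally show ?thesis .
    qed
    moreover have "r / (norm v + 1) > 0" using r(1) by (simp add: add_nonneg_pos)
    ultimately show ?thesis by (intro exI[of _ "r / (norm v + 1)"]) auto
  qed
  have normal: "g \<bullet> w = 0" if "w \<in> tangent_vectors (frontier \<Omega>) p" for w
  proof -
    from that obtain \<epsilon> c where c: "\<epsilon> > 0" "c ` {-\<epsilon><..<\<epsilon>} \<subseteq> frontier \<Omega>" "c 0 = p"
      "(c has_vector_derivative w) (at 0)"
      by (auto simp: tangent_vectors_def)
    have "isCont c 0" using c(4) by (rule has_vector_derivative_continuous)
    with r(1) obtain d where d: "d > 0" "\<And>s. \<bar>s\<bar> < d \<Longrightarrow> dist (c s) p < r"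
      unfolding continuous_at_eps_delta c(3)[symmetric] by (auto simp: dist_real_def)
    have der: "((\<lambda>s. g \<bullet> (c s - p)) has_real_derivative g \<bullet> w) (at 0)"
      using c(4) unfolding has_vector_derivative_def has_field_derivative_def
      by (auto intro!: derivative_eq_intros simp: mult.commute)
    have "\<forall>s. \<bar>0 - s\<bar> < min d \<epsilon> \<longrightarrow> g \<bullet> (c s - p) \<le> g \<bullet> (c 0 - p)"
    proof (intro allI impI)
      fix s :: real assume "\<bar>0 - s\<bar> < min d \<epsilon>"
      then have s: "\<bar>s\<bar> < d" "s \<in> {-\<epsilon><..<\<epsilon>}" by auto
      then obtain W where W: "W \<in> \<W>" "c s \<in> W" using frontier_in_wall c(2) by blast
      from behind[OF W(1) r(2)[OF d(2)[OF s(1)] W] W(2)]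
      show "g \<bullet> (c s - p) \<le> g \<bullet> (c 0 - p)" by (simp add: c(3))
    qed
    from DERIV_local_max[OF der _ this] show ?thesis using d(1) c(1) by simp
  qed
  show ?thesis
    by (rule that[OF g0 behind leaving stay]) (use normal tangent in blast)+
qed

text \<open>
  Since \<open>dN\<close> is constant along rays, criticality of the length of a broken line depends only on
  the directions of its two legs.
\<close>

lemma critical_point_iff_reflection:
  assumes v: "N v = 1" "N w = 1" and \<alpha>: "\<alpha> > 0" "\<beta> > 0"
  shows "critical_point_on S (\<lambda>x. N (x - (p - \<alpha> *\<^sub>R v)) + N (p + \<beta> *\<^sub>R w - x)) p \<longleftrightarrow>
    p \<in> S \<and> (\<forall>x\<in>tangent_vectors S p. dN v x = dN w x)"
proof -
  have nz: "v \<noteq> 0" "w \<noteq> 0" using v by auto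
  let ?f = "\<lambda>x. N (x - (p - \<alpha> *\<^sub>R v)) + N (p + \<beta> *\<^sub>R w - x)"
  let ?D = "\<lambda>h. dN v h - dN w h"
  have "((\<lambda>x. x - (p - \<alpha> *\<^sub>R v)) has_derivative (\<lambda>h. h)) (at p)"
    by (auto intro!: derivative_eq_intros)
  from diff_chain_at[OF this, of N "dN (\<alpha> *\<^sub>R v)"] deriv[of "\<alpha> *\<^sub>R v"] nz \<alpha>
  have 1: "((\<lambda>x. N (x - (p - \<alpha> *\<^sub>R v))) has_derivative dN v) (at p)"
    by (simp add: o_def dN_scale)
  have "((\<lambda>x. p + \<beta> *\<^sub>R w - x) has_derivative (\<lambda>h. - h)) (at p)"
    by (auto intro!: derivative_eq_intros)
  from diff_chain_at[OF this, of N "dN (\<beta> *\<^sub>R w)"] deriv[of "\<beta> *\<^sub>R w"] nz \<alpha>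
  have 2: "((\<lambda>x. N (p + \<beta> *\<^sub>R w - x)) has_derivative (\<lambda>h. - dN w h)) (at p)"
    by (simp add: o_def dN_scale linear_neg[OF linear_dN])
  have D: "(?f has_derivative ?D) (at p)"
    using has_derivative_add[OF 1 2] by simp
  have unique: "D' = ?D" if "(?f has_derivative D') (at p)" for D'
    using has_derivative_unique[OF that D] .
  show ?thesis
  proof
    assume "critical_point_on S ?f p"
    then obtain D' where D': "p \<in> S" "(?f has_derivative D') (at p)"
      "\<And>x. x \<in> tangent_vectors S p \<Longrightarrow> D' x = 0"
      unfolding critical_point_on_def by blast
    then show "p \<in> S \<and> (\<forall>x\<in>tangent_vectors S p. dN v x = dN w x)"
      using unique[OF D'(2)] by force
  next
    assume R: "p \<in> S \<and> (\<forall>x\<in>tangent_vectors S p. dN v x = dN w x)"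
    show "critical_point_on S ?f p"
      unfolding critical_point_on_def by (intro conjI exI[of _ ?D] D) (use R in auto)
  qed
qed

text \<open>
  At a bounce, the momentum \<open>dN\<close> of the velocity jumps by a multiple of the conormal. The sign of
  the multiple follows from two facts: the particle comes from the table and returns to it, so the
  velocity jumps towards the table; and by convexity of \<open>N\<close> the jump of the momentum is nonnegative
  on the jump of the velocity. As the walls lie behind the tangent hyperplane, the jump of the
  momentum is nonpositive on vectors that point into a wall.
\<close>

lemma momentum_jump:
  assumes p: "smooth_boundary_point \<Omega> p" and v: "N v = 1" "N w = 1"
    and arrive: "\<epsilon> > 0" "\<And>s. s \<in> {0<..<\<epsilon>} \<Longrightarrow> p - s *\<^sub>R v \<in> closure \<Omega>"
    and leave: "\<delta> > 0" "\<And>s. s \<in> {0<..<\<delta>} \<Longrightarrow> p + s *\<^sub>R w \<in> closure \<Omega>"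
    and reflect: "\<And>x. x \<in> tangent_vectors (frontier \<Omega>) p \<Longrightarrow> dN v x = dN w x"
    and W: "W \<in> \<W>" "p \<in> W" "q \<in> W"
  shows "dN w (q - p) \<le> dN v (q - p)"
proof -
  obtain g where g0: "g \<noteq> 0"
    and behind: "\<And>W x. W \<in> \<W> \<Longrightarrow> p \<in> W \<Longrightarrow> x \<in> W \<Longrightarrow> g \<bullet> (x - p) \<le> 0"
    and leaving: "\<And>v \<epsilon>. \<epsilon> > 0 \<Longrightarrow> (\<And>s. s \<in> {0<..<\<epsilon>} \<Longrightarrow> p + s *\<^sub>R v \<in> closure \<Omega>) \<Longrightarrow> g \<bullet> v \<ge> 0"
    and stay: "\<And>v. g \<bullet> v \<ge> 0 \<Longrightarrow> \<exists>\<epsilon>>0. \<forall>s\<in>{0..<\<epsilon>}. p + s *\<^sub>R v \<in> closure \<Omega>"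
    and tangent: "\<And>w. w \<in> tangent_vectors (frontier \<Omega>) p \<longleftrightarrow> g \<bullet> w = 0"
    by (fact tangent_half_space[OF p])
  have gv: "g \<bullet> v \<le> 0" using leaving[of \<epsilon> "- v"] arrive by simp
  have gw: "g \<bullet> w \<ge> 0" using leaving[of \<delta> w] leave by simp
  have nz: "v \<noteq> 0" "w \<noteq> 0" using v by auto
  note lin = linear_dN[OF nz(1)] linear_dN[OF nz(2)]
  define L where "L y = dN v y - dN w y" for y
  have L: "L y = (g \<bullet> y) / (g \<bullet> g) * L g" for y
  proof -
    have "g \<bullet> (y - ((g \<bullet> y) / (g \<bullet> g)) *\<^sub>R g) = 0" using g0 by (simp add: inner_diff_right)
    from reflect[OF tangent[THEN iffD2, OF this]]
    have "L (y - ((g \<bullet> y) / (g \<bullet> g)) *\<^sub>R g) = 0" by (simp add: L_def)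
    then show ?thesis
      by (simp add: L_def linear_diff[OF lin(1)] linear_diff[OF lin(2)] linear_scale[OF lin(1)]
          linear_scale[OF lin(2)] right_diff_distrib)
  qed
  have gg: "g \<bullet> g > 0" using g0 by simp
  have Lv: "L v \<ge> 0" using dN_le[OF nz(2), of v] dN_self[OF nz(1)] v by (simp add: L_def)
  have Lw: "L w \<le> 0" using dN_le[OF nz(1), of w] dN_self[OF nz(2)] v by (simp add: L_def)
  have "L g \<le> 0"
  proof (rule ccontr)
    assume Lg: "\<not> L g \<le> 0"
    have "g \<bullet> v = 0"
    proof (rule ccontr)
      assume "g \<bullet> v \<noteq> 0"
      then have "(g \<bullet> v) / (g \<bullet> g) * L g < 0" using gv gg Lg by (simp add: divide_neg_pos mult_neg_pos)
      then show False using L[of v] Lv by simp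
    qed
    \<comment> \<open>A tangential arrival is no bounce at all.\<close>
    then have "dN w v = 1" using L[of v] dN_self[OF nz(1)] v by (simp add: L_def)
    from dN_eq_unit[OF v(2,1) this] have "L g = 0" by (simp add: L_def)
    with Lg show False by simp
  qed
  moreover have "(g \<bullet> (q - p)) / (g \<bullet> g) \<le> 0" using behind[OF W] gg by (simp add: divide_nonpos_pos)
  ultimately have "L (q - p) \<ge> 0" by (subst L) (rule mult_nonpos_nonpos)
  then show ?thesis by (simp add: L_def)
qed

text \<open>
  A particle that arrives at a point other than a non-smooth boundary point can move on: straight
  inside the table or along the boundary, and by reflection otherwise.
\<close>

lemma continuation:
  assumes p: "p \<in> \<Omega> \<or> smooth_boundary_point \<Omega> p" and v: "N v = 1"
    and arrive: "\<epsilon> > 0" "\<And>s. s \<in> {0<..<\<epsilon>} \<Longrightarrow> p - s *\<^sub>R v \<in> closure \<Omega>"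
  obtains w \<delta> where "N w = 1" "\<delta> > 0" "\<And>s. s \<in> {0..\<delta>} \<Longrightarrow> p + s *\<^sub>R w \<in> closure \<Omega>"
    "w = v \<or> smooth_boundary_point \<Omega> p \<and>
       (\<forall>x\<in>tangent_vectors (frontier \<Omega>) p. dN v x = dN w x)"
proof (cases "p \<in> \<Omega>")
  case True
  then obtain r where r: "r > 0" "ball p r \<subseteq> \<Omega>" using open_table by (meson open_contains_ball)
  have v0: "norm v > 0" using v by auto
  show ?thesis
  proof (rule that[of v "r / (2 * norm v)"])
    fix s assume "s \<in> {0..r / (2 * norm v)}"
    then have "s * norm v \<le> r/2" "s \<ge> 0" using v0 by (auto simp: field_simps)
    then have "p + s *\<^sub>R v \<in> ball p r" using r(1) by (simp add: dist_norm)
    then show "p + s *\<^sub>R v \<in> closure \<Omega>" using r(2) closure_subset by blast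
  qed (use r v v0 in auto)
next
  case False
  with p have sp: "smooth_boundary_point \<Omega> p" by simp
  obtain g where g0: "g \<noteq> 0"
    and behind: "\<And>W x. W \<in> \<W> \<Longrightarrow> p \<in> W \<Longrightarrow> x \<in> W \<Longrightarrow> g \<bullet> (x - p) \<le> 0"
    and leaving: "\<And>v \<epsilon>. \<epsilon> > 0 \<Longrightarrow> (\<And>s. s \<in> {0<..<\<epsilon>} \<Longrightarrow> p + s *\<^sub>R v \<in> closure \<Omega>) \<Longrightarrow> g \<bullet> v \<ge> 0"
    and stay: "\<And>v. g \<bullet> v \<ge> 0 \<Longrightarrow> \<exists>\<epsilon>>0. \<forall>s\<in>{0..<\<epsilon>}. p + s *\<^sub>R v \<in> closure \<Omega>"
    and tangent: "\<And>w. w \<in> tangent_vectors (frontier \<Omega>) p \<longleftrightarrow> g \<bullet> w = 0"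
    by (fact tangent_half_space[OF sp])
  have gv: "g \<bullet> v \<le> 0" using leaving[of \<epsilon> "- v"] arrive by simp
  obtain w where w: "N w = 1" "g \<bullet> w \<ge> 0"
    "w = v \<or> (\<forall>x\<in>tangent_vectors (frontier \<Omega>) p. dN v x = dN w x)"
  proof (cases "g \<bullet> v = 0")
    case True
    then show ?thesis using that[of v] v by simp
  next
    case False
    with gv have "g \<bullet> v < 0" by simp
    from reflected_direction[OF v this] show ?thesis using that tangent by (metis less_imp_le)
  qed
  obtain d where d: "d > 0" "\<And>s. s \<in> {0..<d} \<Longrightarrow> p + s *\<^sub>R w \<in> closure \<Omega>"
    using stay[OF w(2)] by blast
  show ?thesis
    by (rule that[of w "d/2"]) (use w d sp in auto)
qed

text \<open>
  An artificial past for a particle that starts at \<open>p\<close>, which makes the preceding lemma applicable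
  to trajectories consisting of a single instant.
\<close>

lemma arrival_exists:
  assumes p: "p \<in> \<Omega> \<or> smooth_boundary_point \<Omega> p"
  obtains v \<epsilon> where "N v = 1" "\<epsilon> > 0" "\<And>s. s \<in> {0<..<\<epsilon>} \<Longrightarrow> p - s *\<^sub>R v \<in> closure \<Omega>"
proof (cases "p \<in> \<Omega>")
  case True
  then obtain r where r: "r > 0" "ball p r \<subseteq> \<Omega>" using open_table by (meson open_contains_ball)
  obtain v where v: "N v = 1" using unit_vector_exists by blast
  then have v0: "norm v > 0" by auto
  show ?thesis
  proof (rule that[of v "r / norm v"])
    fix s assume "s \<in> {0<..<r / norm v}"
    then have "s * norm v < r" "s > 0" using v0 by (auto simp: field_simps)
    then have "p - s *\<^sub>R v \<in> ball p r" by (simp add: dist_norm)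
    then show "p - s *\<^sub>R v \<in> closure \<Omega>" using r(2) closure_subset by blast
  qed (use r v v0 in auto)
next
  case False
  with p have sp: "smooth_boundary_point \<Omega> p" by simp
  obtain g where g0: "g \<noteq> 0"
    and behind: "\<And>W x. W \<in> \<W> \<Longrightarrow> p \<in> W \<Longrightarrow> x \<in> W \<Longrightarrow> g \<bullet> (x - p) \<le> 0"
    and leaving: "\<And>v \<epsilon>. \<epsilon> > 0 \<Longrightarrow> (\<And>s. s \<in> {0<..<\<epsilon>} \<Longrightarrow> p + s *\<^sub>R v \<in> closure \<Omega>) \<Longrightarrow> g \<bullet> v \<ge> 0"
    and stay: "\<And>v. g \<bullet> v \<ge> 0 \<Longrightarrow> \<exists>\<epsilon>>0. \<forall>s\<in>{0..<\<epsilon>}. p + s *\<^sub>R v \<in> closure \<Omega>"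
    and tangent: "\<And>w. w \<in> tangent_vectors (frontier \<Omega>) p \<longleftrightarrow> g \<bullet> w = 0"
    by (fact tangent_half_space[OF sp])
  have pg: "N (- g) > 0" using g0 by (simp add: pos)
  define v where "v = (1 / N (- g)) *\<^sub>R (- g)"
  have "g \<bullet> (- v) \<ge> 0" using pg by (simp add: v_def)
  then obtain d where "d > 0" "\<And>s. s \<in> {0..<d} \<Longrightarrow> p + s *\<^sub>R (- v) \<in> closure \<Omega>"
    using stay by blast
  moreover have "N v = 1" unfolding v_def using pg by (subst homogeneous) auto
  ultimately show ?thesis by (intro that[of v d]) auto
qed

end

section \<open>Trajectories as curves with one-sided velocities\<close>

lemma interior_contains:
  assumes "is_interval I" "a \<in> I" "b \<in> I"
  shows "{a<..<b} \<subseteq> interior (I :: real set)"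
proof (rule interior_maximal)
  show "{a<..<b} \<subseteq> I" using mem_is_interval_1_I[OF assms] by auto
qed simp

context semi_dispersing_table
begin

text \<open>
  The condition on a trajectory at an interior time \<open>t\<close>, expressed by the one-sided velocities \<open>v\<close>
  and \<open>w\<close> instead of the positions at two auxiliary times. In this form it is visibly local.
\<close>

definition deflects :: "(real \<Rightarrow> 'a) \<Rightarrow> real \<Rightarrow> real \<Rightarrow> 'a \<Rightarrow> 'a \<Rightarrow> bool" where
  "deflects \<gamma> t \<delta> v w \<longleftrightarrow> \<delta> > 0 \<and> N v = 1 \<and> N w = 1 \<and>
     (\<forall>s\<in>{0..<\<delta>}. \<gamma> (t - s) = \<gamma> t - s *\<^sub>R v) \<and> (\<forall>s\<in>{0..<\<delta>}. \<gamma> (t + s) = \<gamma> t + s *\<^sub>R w) \<and>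
     (w = v \<or> smooth_boundary_point \<Omega> (\<gamma> t) \<and>
        (\<forall>x\<in>tangent_vectors (frontier \<Omega>) (\<gamma> t). dN v x = dN w x))"

lemma deflects_cong:
  assumes "deflects \<gamma> t \<delta> v w" "\<delta>' > 0" "\<delta>' \<le> \<delta>" "\<And>u. u \<in> {t - \<delta>'<..<t + \<delta>'} \<Longrightarrow> \<eta> u = \<gamma> u"
  shows "deflects \<eta> t \<delta>' v w"
proof -
  have "\<eta> t = \<gamma> t" "\<And>s. s \<in> {0..<\<delta>'} \<Longrightarrow> \<eta> (t - s) = \<gamma> (t - s)"
    "\<And>s. s \<in> {0..<\<delta>'} \<Longrightarrow> \<eta> (t + s) = \<gamma> (t + s)" using assms(2) by (auto intro!: assms(4))
  then show ?thesis using assms(1-3) unfolding deflects_def by auto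
qed

lemma deflects_backward:
  "deflects \<gamma> t \<delta> v w \<Longrightarrow> u \<in> {t - \<delta><..t} \<Longrightarrow> \<gamma> u = \<gamma> t - (t - u) *\<^sub>R v"
  unfolding deflects_def by (auto dest!: bspec[of _ _ "t - u"])

lemma deflects_forward:
  "deflects \<gamma> t \<delta> v w \<Longrightarrow> u \<in> {t..<t + \<delta>} \<Longrightarrow> \<gamma> u = \<gamma> t + (u - t) *\<^sub>R w"
  unfolding deflects_def by (auto dest!: bspec[of _ _ "u - t"])

lemma trajectory_iff_deflects:
  "billiard_trajectory N \<Omega> I \<gamma> \<longleftrightarrow>
     is_interval I \<and> I \<noteq> {} \<and> continuous_on I \<gamma> \<and> \<gamma> ` I \<subseteq> closure \<Omega> \<and>
     (\<forall>t\<in>interior I. \<exists>\<delta> v w. {t - \<delta><..<t + \<delta>} \<subseteq> I \<and> deflects \<gamma> t \<delta> v w)"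
proof -
  have "(\<exists>\<delta>>0. {t - \<delta><..<t + \<delta>} \<subseteq> I \<and> (\<forall>t1\<in>{t - \<delta><..<t}. \<forall>t2\<in>{t<..<t + \<delta>}.
           unit_speed_segment N \<gamma> t1 t2 \<or> bounces_at N \<Omega> \<gamma> t1 t t2)) \<longleftrightarrow>
        (\<exists>\<delta> v w. {t - \<delta><..<t + \<delta>} \<subseteq> I \<and> deflects \<gamma> t \<delta> v w)"
    (is "?L \<longleftrightarrow> ?R") for t
  proof
    assume ?L
    then obtain \<delta> where \<delta>: "\<delta> > 0" "{t - \<delta><..<t + \<delta>} \<subseteq> I"
      "\<And>t1 t2. t1\<in>{t - \<delta><..<t} \<Longrightarrow> t2\<in>{t<..<t + \<delta>} \<Longrightarrow>
           unit_speed_segment N \<gamma> t1 t2 \<or> bounces_at N \<Omega> \<gamma> t1 t t2" by metis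
    define d where "d = \<delta> / 2"
    have d: "0 < d" "d < \<delta>" using \<delta>(1) by (auto simp: d_def)
    have "unit_speed_segment N \<gamma> (t - d) (t + d) \<or> bounces_at N \<Omega> \<gamma> (t - d) t (t + d)"
      using d by (intro \<delta>(3)) auto
    then have "\<exists>v w. deflects \<gamma> t d v w"
    proof
      assume "unit_speed_segment N \<gamma> (t - d) (t + d)"
      then obtain v where v: "N v = 1" "\<And>u. u\<in>{t - d..t + d} \<Longrightarrow> \<gamma> u = \<gamma> (t - d) + (u - (t - d)) *\<^sub>R v"
        unfolding unit_speed_segment_def by blast
      have t: "\<gamma> t = \<gamma> (t - d) + d *\<^sub>R v" using v(2)[of t] d by simp
      have "\<gamma> (t - s) = \<gamma> t - s *\<^sub>R v" "\<gamma> (t + s) = \<gamma> t + s *\<^sub>R v" if "s \<in> {0..<d}" for s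
        using v(2)[of "t - s"] v(2)[of "t + s"] t that by (auto simp: algebra_simps)
      then have "deflects \<gamma> t d v v" using v(1) d by (simp add: deflects_def)
      then show ?thesis by blast
    next
      assume B: "bounces_at N \<Omega> \<gamma> (t - d) t (t + d)"
      obtain v where v: "N v = 1" "\<And>u. u\<in>{t - d..t} \<Longrightarrow> \<gamma> u = \<gamma> (t - d) + (u - (t - d)) *\<^sub>R v"
        using B unfolding bounces_at_def unit_speed_segment_def by blast
      obtain w where w: "N w = 1" "\<And>u. u\<in>{t..t + d} \<Longrightarrow> \<gamma> u = \<gamma> t + (u - t) *\<^sub>R w"
        using B unfolding bounces_at_def unit_speed_segment_def by blast
      have t: "\<gamma> t = \<gamma> (t - d) + d *\<^sub>R v" using v(2)[of t] d by simp
      have ends: "\<gamma> (t - d) = \<gamma> t - d *\<^sub>R v" "\<gamma> (t + d) = \<gamma> t + d *\<^sub>R w"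
        using t w(2)[of "t + d"] d by auto
      have "\<gamma> (t - s) = \<gamma> t - s *\<^sub>R v" "\<gamma> (t + s) = \<gamma> t + s *\<^sub>R w" if "s \<in> {0..<d}" for s
        using v(2)[of "t - s"] w(2)[of "t + s"] t that by (auto simp: algebra_simps)
      moreover have "\<forall>x\<in>tangent_vectors (frontier \<Omega>) (\<gamma> t). dN v x = dN w x"
        using B critical_point_iff_reflection[OF v(1) w(1) d(1) d(1)]
        unfolding bounces_at_def ends by blast
      ultimately have "deflects \<gamma> t d v w"
        using v(1) w(1) d B by (simp add: deflects_def bounces_at_def)
      then show ?thesis by blast
    qed
    moreover have "{t - d<..<t + d} \<subseteq> I" using \<delta>(2) d by (auto simp: subset_iff)
    ultimately show ?R by blast
  next
    assume ?R
    then obtain \<delta> v w where \<delta>: "{t - \<delta><..<t + \<delta>} \<subseteq> I" and D: "deflects \<gamma> t \<delta> v w" by blast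
    have v: "N v = 1" "N w = 1" "\<delta> > 0" using D by (auto simp: deflects_def)
    have "unit_speed_segment N \<gamma> t1 t2 \<or> bounces_at N \<Omega> \<gamma> t1 t t2"
      if t1: "t1 \<in> {t - \<delta><..<t}" and t2: "t2 \<in> {t<..<t + \<delta>}" for t1 t2
    proof -
      have b: "\<gamma> u = \<gamma> t - (t - u) *\<^sub>R v" if "u \<in> {t1..t}" for u
        using deflects_backward[OF D, of u] that t1 by auto
      have f: "\<gamma> u = \<gamma> t + (u - t) *\<^sub>R w" if "u \<in> {t..t2}" for u
        using deflects_forward[OF D, of u] that t2 by auto
      have e1: "\<gamma> t1 = \<gamma> t - (t - t1) *\<^sub>R v" and e2: "\<gamma> t2 = \<gamma> t + (t2 - t) *\<^sub>R w"
        using b[of t1] f[of t2] t1 t2 by auto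
      have s1: "\<gamma> u = \<gamma> t1 + (u - t1) *\<^sub>R v" if "u \<in> {t1..t}" for u
        unfolding b[OF that] e1 by (simp add: algebra_simps)
      show ?thesis
      proof (cases "w = v")
        case True
        have "\<gamma> u = \<gamma> t1 + (u - t1) *\<^sub>R v" if "u \<in> {t1..t2}" for u
        proof (cases "u \<le> t")
          case True
          then show ?thesis using that by (intro s1) simp
        next
          case False
          then have "u \<in> {t..t2}" using that by auto
          from f[OF this] show ?thesis unfolding e1 \<open>w = v\<close> by (simp add: algebra_simps)
        qed
        then show ?thesis using v unfolding unit_speed_segment_def by blast
      next
        case False
        with D have sp: "smooth_boundary_point \<Omega> (\<gamma> t)"
          and R: "\<forall>x\<in>tangent_vectors (frontier \<Omega>) (\<gamma> t). dN v x = dN w x"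
          by (auto simp: deflects_def)
        have "unit_speed_segment N \<gamma> t1 t" "unit_speed_segment N \<gamma> t t2"
          using s1 f v unfolding unit_speed_segment_def by blast+
        moreover have "critical_point_on (frontier \<Omega>) (\<lambda>x. N (x - \<gamma> t1) + N (\<gamma> t2 - x)) (\<gamma> t)"
          unfolding e1 e2
          by (rule critical_point_iff_reflection[OF v(1,2), THEN iffD2])
             (use R sp t1 t2 in \<open>auto simp: smooth_boundary_point_def\<close>)
        ultimately show ?thesis using sp by (simp add: bounces_at_def)
      qed
    qed
    with \<delta> v(3) show ?L by blast
  qed
  then show ?thesis unfolding billiard_trajectory_def by simp
qed

text \<open>
  On a compact interval of interior times the bound is local and additive, so it holds by bisection;
  continuity carries it over to the endpoints, where bounces might accumulate.
\<close>

lemma trajectory_1_lipschitz: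
  assumes traj: "billiard_trajectory N \<Omega> I \<gamma>" and c: "c \<in> I" "d \<in> I" "c \<le> d"
  shows "N (\<gamma> d - \<gamma> c) \<le> d - c"
proof (cases "c = d")
  case False
  with c have cd: "c < d" by simp
  have I: "is_interval I" "continuous_on I \<gamma>"
    and D: "\<And>t. t \<in> interior I \<Longrightarrow> \<exists>\<delta> v w. {t - \<delta><..<t + \<delta>} \<subseteq> I \<and> deflects \<gamma> t \<delta> v w"
    using traj unfolding trajectory_iff_deflects by auto
  note int = interior_contains[OF I(1) c(1,2)]
  have inner: "N (\<gamma> y - \<gamma> x) \<le> y - x" if xy: "c < x" "x \<le> y" "y < d" for x y
    using xy(2)
  proof (induction rule: Bolzano)
    case (trans p q r)
    then show ?case using triangle[of "\<gamma> r - \<gamma> q" "\<gamma> q - \<gamma> p"] by simp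
  next
    case (local t)
    then have "t \<in> interior I" using xy int by auto
    from D[OF this] obtain \<delta> v w where \<delta>: "deflects \<gamma> t \<delta> v w" by blast
    then have v: "\<delta> > 0" "N v = 1" "N w = 1" by (auto simp: deflects_def)
    have "N (\<gamma> q - \<gamma> p) \<le> q - p" if pq: "p \<le> t" "t \<le> q" "q - p < \<delta>" for p q
    proof -
      have "\<gamma> p = \<gamma> t - (t - p) *\<^sub>R v" "\<gamma> q = \<gamma> t + (q - t) *\<^sub>R w"
        using pq by (auto intro!: deflects_backward[OF \<delta>] deflects_forward[OF \<delta>])
      then have "\<gamma> q - \<gamma> p = (q - t) *\<^sub>R w + (t - p) *\<^sub>R v" by simp
      then show ?thesis
        using triangle[of "(q - t) *\<^sub>R w" "(t - p) *\<^sub>R v"] v pq by (simp add: homogeneous)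
    qed
    then show ?case using v(1) by blast
  qed
  define m where "m = (d - c) / 2"
  have m: "m > 0" using cd by (simp add: m_def)
  let ?F = "\<lambda>h. N (\<gamma> (d - h) - \<gamma> (c + h))"
  have sub: "{c..d} \<subseteq> I" using mem_is_interval_1_I[OF I(1) c(1,2)] by auto
  have "?F 0 \<le> d - c"
  proof (rule continuous_le_on_closure[where f="?F" and S="{0<..<m}" and x=0])
    have "continuous_on {0..m} ?F"
      by (intro continuous_intros continuous_on_compose2[OF continuous]
          continuous_on_compose2[OF I(2)] subset_UNIV)
         (use sub in \<open>auto simp: m_def field_simps subset_iff\<close>)
    then show "continuous_on (closure {0<..<m}) ?F" using m by simp
    show "0 \<in> closure {0<..<m}" using m by simp
    show "?F h \<le> d - c" if "h \<in> {0<..<m}" for h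
      using inner[of "c + h" "d - h"] that by (auto simp: m_def field_simps)
  qed
  then show ?thesis by simp
qed simp

text \<open>By strict convexity, a curve of speed at most one that realizes the distance is a segment.\<close>

lemma segment_if_distance_realizing:
  assumes st: "s < t"
    and lip: "\<And>x y. s \<le> x \<Longrightarrow> x \<le> y \<Longrightarrow> y \<le> t \<Longrightarrow> N (\<gamma> y - \<gamma> x) \<le> y - x"
    and far: "t - s \<le> N (\<gamma> t - \<gamma> s)"
  shows "unit_speed_segment N \<gamma> s t"
proof -
  define v where "v = (1 / (t - s)) *\<^sub>R (\<gamma> t - \<gamma> s)"
  have dist: "N (\<gamma> t - \<gamma> s) = t - s" using far lip[of s t] st by simp
  have "N v = 1" unfolding v_def using dist st by (simp add: homogeneous)
  moreover have "\<gamma> u = \<gamma> s + (u - s) *\<^sub>R v" if u: "u \<in> {s..t}" for u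
  proof -
    let ?x = "\<gamma> u - \<gamma> s" and ?y = "\<gamma> t - \<gamma> u"
    have xy: "?x + ?y = \<gamma> t - \<gamma> s" by simp
    have "N ?x \<le> u - s" "N ?y \<le> t - u" using u lip by auto
    moreover have "t - s \<le> N ?x + N ?y" using triangle[of ?x ?y] dist xy by simp
    ultimately have N: "N ?x = u - s" "N (?x + ?y) = N ?x + N ?y" using dist xy by auto
    have "?x + ?y \<noteq> 0" using dist st xy by auto
    from triangle_eq[OF N(2) this] have "?x = ((u - s) / (t - s)) *\<^sub>R (\<gamma> t - \<gamma> s)"
      using N(1) dist xy by simp
    then show ?thesis by (simp add: v_def algebra_simps)
  qed
  ultimately show ?thesis unfolding unit_speed_segment_def by blast
qed

section \<open>Straightness near a point common to all walls\<close>

definition right_velocity :: "(real \<Rightarrow> 'a) \<Rightarrow> real \<Rightarrow> 'a" where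
  "right_velocity \<gamma> u = vector_derivative \<gamma> (at u within {u..})"

lemma right_velocity_eq:
  assumes "e > 0" "\<And>z. z \<in> {u..<u + e} \<Longrightarrow> \<gamma> z = \<gamma> u + (z - u) *\<^sub>R w"
  shows "right_velocity \<gamma> u = w"
  unfolding right_velocity_def
proof (rule vector_derivative_within)
  have "((\<lambda>z. \<gamma> u + (z - u) *\<^sub>R w) has_vector_derivative w) (at u within {u..})"
    by (auto intro!: derivative_eq_intros)
  then show "(\<gamma> has_vector_derivative w) (at u within {u..})"
  proof (rule has_vector_derivative_transform_within[where d=e])
    show "\<gamma> u + (z - u) *\<^sub>R w = \<gamma> z" if "z \<in> {u..}" "dist z u < e" for z
      using that by (intro assms(2)[symmetric]) (simp add: dist_real_def abs_less_iff)
  qed (use assms(1) in auto)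
  show "at u within {u..} \<noteq> bot"
    by (rule trivial_limit_at_right_real[of u, THEN contrapos_nn])
       (auto simp: at_within_Ici_at_right)
qed

text \<open>
  As \<open>dN v \<le> N\<close>, this is a lower bound for the time at which a particle of unit speed that is at
  \<open>\<gamma> u\<close> at time \<open>u\<close> can be at \<open>q\<close>.
\<close>

definition arrival_bound :: "(real \<Rightarrow> 'a) \<Rightarrow> 'a \<Rightarrow> real \<Rightarrow> real" where
  "arrival_bound \<gamma> q u = u + dN (right_velocity \<gamma> u) (q - \<gamma> u)"

text \<open>
  The key monotonicity, for a point \<open>q\<close> common to all walls that the particle touches. Along a free
  segment the bound is constant, since \<open>dN v v = N v = 1\<close>; at a bounce it can only jump down, because
  \<open>q - \<gamma> t\<close> points into the wall. The number of bounces does not enter: the statement is local in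
  time and passes to intervals by bisection.
\<close>

lemma arrival_bound_antimono:
  assumes traj: "billiard_trajectory N \<Omega> I \<gamma>"
    and int: "{a<..<b} \<subseteq> interior I"
    and q: "\<And>t W. t \<in> {a<..<b} \<Longrightarrow> W \<in> \<W> \<Longrightarrow> \<gamma> t \<in> W \<Longrightarrow> q \<in> W"
    and cd: "a < c" "c \<le> d" "d < b"
  shows "arrival_bound \<gamma> q d \<le> arrival_bound \<gamma> q c"
  using cd(2)
proof (induction rule: Bolzano)
  case (local t)
  have D: "\<And>t. t \<in> interior I \<Longrightarrow> \<exists>\<delta> v w. {t - \<delta><..<t + \<delta>} \<subseteq> I \<and> deflects \<gamma> t \<delta> v w"
    and inside: "\<gamma> ` I \<subseteq> closure \<Omega>"
    using traj unfolding trajectory_iff_deflects by auto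
  have t: "t \<in> {a<..<b}" using local cd by auto
  then have "t \<in> interior I" using int by auto
  from D[OF this] obtain \<delta> v w where \<delta>: "{t - \<delta><..<t + \<delta>} \<subseteq> I" "deflects \<gamma> t \<delta> v w" by blast
  then have v: "\<delta> > 0" "N v = 1" "N w = 1" and refl: "w = v \<or> smooth_boundary_point \<Omega> (\<gamma> t) \<and>
        (\<forall>x\<in>tangent_vectors (frontier \<Omega>) (\<gamma> t). dN v x = dN w x)" by (auto simp: deflects_def)
  have nz: "v \<noteq> 0" "w \<noteq> 0" using v by auto
  have after: "arrival_bound \<gamma> q u = t + dN w (q - \<gamma> t)" if u: "u \<in> {t..<t + \<delta>}" for u
  proof -
    note f = deflects_forward[OF \<delta>(2)]
    have rv: "right_velocity \<gamma> u = w"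
    proof (rule right_velocity_eq[of "t + \<delta> - u"])
      show "\<gamma> z = \<gamma> u + (z - u) *\<^sub>R w" if "z \<in> {u..<u + (t + \<delta> - u)}" for z
      proof -
        have "z \<in> {t..<t + \<delta>}" using that u by auto
        then show ?thesis unfolding f[OF u] by (subst f) (simp_all add: algebra_simps)
      qed
    qed (use u in auto)
    have qu: "q - \<gamma> u = (q - \<gamma> t) - (u - t) *\<^sub>R w" using f[OF u] by simp
    show ?thesis
      unfolding arrival_bound_def rv qu linear_diff[OF linear_dN[OF nz(2)]]
        linear_scale[OF linear_dN[OF nz(2)]] dN_self[OF nz(2)] using v by simp
  qed
  have before: "arrival_bound \<gamma> q u = t + dN v (q - \<gamma> t)" if u: "u \<in> {t - \<delta><..<t}" for u
  proof -
    note f = deflects_backward[OF \<delta>(2)]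
    have rv: "right_velocity \<gamma> u = v"
    proof (rule right_velocity_eq[of "t - u"])
      show "\<gamma> z = \<gamma> u + (z - u) *\<^sub>R v" if "z \<in> {u..<u + (t - u)}" for z
      proof -
        have "z \<in> {t - \<delta><..t}" "u \<in> {t - \<delta><..t}" using that u by auto
        then show ?thesis unfolding f[OF \<open>u \<in> {t - \<delta><..t}\<close>] by (subst f) (simp_all add: algebra_simps)
      qed
    qed (use u in auto)
    have qu: "q - \<gamma> u = (q - \<gamma> t) + (t - u) *\<^sub>R v" using f[of u] u by simp
    show ?thesis
      unfolding arrival_bound_def rv qu linear_add[OF linear_dN[OF nz(1)]]
        linear_scale[OF linear_dN[OF nz(1)]] dN_self[OF nz(1)] using v by simp
  qed
  have jump: "dN w (q - \<gamma> t) \<le> dN v (q - \<gamma> t)"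
  proof (cases "w = v")
    case False
    with refl have sp: "smooth_boundary_point \<Omega> (\<gamma> t)"
      and R: "\<And>x. x \<in> tangent_vectors (frontier \<Omega>) (\<gamma> t) \<Longrightarrow> dN v x = dN w x" by auto
    obtain W where W: "W \<in> \<W>" "\<gamma> t \<in> W"
      using frontier_in_wall sp by (auto simp: smooth_boundary_point_def)
    have stay: "\<gamma> u \<in> closure \<Omega>" if "u \<in> {t - \<delta><..<t + \<delta>}" for u
      using \<delta>(1) inside that by blast
    show ?thesis
    proof (rule momentum_jump[OF sp v(2,3) v(1) _ v(1) _ R W q[OF t W]])
      show "\<gamma> t - s *\<^sub>R v \<in> closure \<Omega>" if "s \<in> {0<..<\<delta>}" for s
        using stay[of "t - s"] deflects_backward[OF \<delta>(2), of "t - s"] that by auto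
      show "\<gamma> t + s *\<^sub>R w \<in> closure \<Omega>" if "s \<in> {0<..<\<delta>}" for s
        using stay[of "t + s"] deflects_forward[OF \<delta>(2), of "t + s"] that by auto
    qed
  qed simp
  have "arrival_bound \<gamma> q y \<le> arrival_bound \<gamma> q x" if "x \<le> t" "t \<le> y" "y - x < \<delta>" for x y
  proof (cases "x = t")
    case True
    then show ?thesis using after[of x] after[of y] that v(1) by simp
  next
    case False
    then show ?thesis using before[of x] after[of y] that jump by simp
  qed
  then show ?case using v(1) by blast
qed simp

lemma right_velocity_unit:
  assumes traj: "billiard_trajectory N \<Omega> I \<gamma>" and t: "t \<in> interior I"
  shows "N (right_velocity \<gamma> t) = 1"
proof -
  obtain \<delta> v w where D: "deflects \<gamma> t \<delta> v w"
    using traj t unfolding trajectory_iff_deflects by blast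
  then have "\<delta> > 0" by (simp add: deflects_def)
  then have "right_velocity \<gamma> t = w"
    by (rule right_velocity_eq[OF _ deflects_forward[OF D]])
  with D show ?thesis by (simp add: deflects_def)
qed

text \<open>
  When the particle itself reaches \<open>q = \<gamma> b\<close>, the limit of the bound at \<open>b\<close> is at least \<open>b\<close>. By
  monotonicity it is at least \<open>b\<close> at all earlier times \<open>u\<close>, so the remaining time \<open>b - u\<close> does not
  exceed the distance to \<open>q\<close>: the particle takes a shortest way.
\<close>

lemma straight_into_common_point:
  assumes traj: "billiard_trajectory N \<Omega> I \<gamma>" and ab: "a \<in> I" "b \<in> I"
    and q: "\<And>t W. t \<in> {a<..<b} \<Longrightarrow> W \<in> \<W> \<Longrightarrow> \<gamma> t \<in> W \<Longrightarrow> \<gamma> b \<in> W"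
    and u: "a < u" "u < b"
  shows "unit_speed_segment N \<gamma> u b"
proof (rule segment_if_distance_realizing[OF u(2)])
  have I: "is_interval I" "continuous_on I \<gamma>"
    using traj unfolding trajectory_iff_deflects by auto
  note int = interior_contains[OF I(1) ab]
  have sub: "{a..b} \<subseteq> I" using mem_is_interval_1_I[OF I(1) ab] by auto
  show "N (\<gamma> y - \<gamma> x) \<le> y - x" if "u \<le> x" "x \<le> y" "y \<le> b" for x y
    using that u by (intro trajectory_1_lipschitz[OF traj] sub[THEN subsetD]) auto
  have unit: "right_velocity \<gamma> t \<noteq> 0" if "t \<in> {a<..<b}" for t
    using right_velocity_unit[OF traj, of t] int that by auto
  let ?F = "\<lambda>t. t - N (\<gamma> t - \<gamma> b)"
  have "?F b \<le> arrival_bound \<gamma> (\<gamma> b) u"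
  proof (rule continuous_le_on_closure[where f="?F" and S="{u<..<b}" and x=b])
    have "continuous_on {u..b} ?F"
      by (intro continuous_intros continuous_on_compose2[OF continuous]
          continuous_on_compose2[OF I(2)] subset_UNIV)
         (use sub u in \<open>auto simp: subset_iff\<close>)
    then show "continuous_on (closure {u<..<b}) ?F" using u by simp
    show "b \<in> closure {u<..<b}" using u by simp
    show "?F t \<le> arrival_bound \<gamma> (\<gamma> b) u" if t: "t \<in> {u<..<b}" for t
    proof -
      have "?F t \<le> arrival_bound \<gamma> (\<gamma> b) t"
        using dN_ge[OF unit, of t "\<gamma> b - \<gamma> t"] t u by (simp add: arrival_bound_def)
      also have "\<dots> \<le> arrival_bound \<gamma> (\<gamma> b) u"
        using t u by (intro arrival_bound_antimono[OF traj int q]) auto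
      finally show ?thesis .
    qed
  qed
  also have "arrival_bound \<gamma> (\<gamma> b) u \<le> u + N (\<gamma> b - \<gamma> u)"
    using dN_le[OF unit, of u "\<gamma> b - \<gamma> u"] u by (simp add: arrival_bound_def)
  finally show "b - u \<le> N (\<gamma> b - \<gamma> u)" by simp
qed

text \<open>
  The same for a particle that starts at \<open>q = \<gamma> a\<close>: the limit of the bound at \<open>a\<close> is at most \<open>a\<close>, and
  by monotonicity so is the bound at later times.
\<close>

lemma straight_from_common_point:
  assumes traj: "billiard_trajectory N \<Omega> I \<gamma>" and ab: "a \<in> I" "b \<in> I"
    and q: "\<And>t W. t \<in> {a<..<b} \<Longrightarrow> W \<in> \<W> \<Longrightarrow> \<gamma> t \<in> W \<Longrightarrow> \<gamma> a \<in> W"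
    and u: "a < u" "u < b"
  shows "unit_speed_segment N \<gamma> a u"
proof (rule segment_if_distance_realizing[OF u(1)])
  have I: "is_interval I" "continuous_on I \<gamma>"
    using traj unfolding trajectory_iff_deflects by auto
  note int = interior_contains[OF I(1) ab]
  have sub: "{a..b} \<subseteq> I" using mem_is_interval_1_I[OF I(1) ab] by auto
  show "N (\<gamma> y - \<gamma> x) \<le> y - x" if "a \<le> x" "x \<le> y" "y \<le> u" for x y
    using that u by (intro trajectory_1_lipschitz[OF traj] sub[THEN subsetD]) auto
  have unit: "right_velocity \<gamma> t \<noteq> 0" if "t \<in> {a<..<b}" for t
    using right_velocity_unit[OF traj, of t] int that by auto
  let ?F = "\<lambda>t. t + N (\<gamma> a - \<gamma> t)"
  have "arrival_bound \<gamma> (\<gamma> a) u \<le> ?F a"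
  proof (rule continuous_ge_on_closure[where f="?F" and S="{a<..<u}" and x=a])
    have "continuous_on {a..u} ?F"
      by (intro continuous_intros continuous_on_compose2[OF continuous]
          continuous_on_compose2[OF I(2)] subset_UNIV)
         (use sub u in \<open>auto simp: subset_iff\<close>)
    then show "continuous_on (closure {a<..<u}) ?F" using u by simp
    show "a \<in> closure {a<..<u}" using u by simp
    show "arrival_bound \<gamma> (\<gamma> a) u \<le> ?F t" if t: "t \<in> {a<..<u}" for t
    proof -
      have "arrival_bound \<gamma> (\<gamma> a) u \<le> arrival_bound \<gamma> (\<gamma> a) t"
        using t u by (intro arrival_bound_antimono[OF traj int q]) auto
      also have "\<dots> \<le> ?F t"
        using dN_le[OF unit, of t "\<gamma> a - \<gamma> t"] t u by (simp add: arrival_bound_def)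
      finally show ?thesis .
    qed
  qed
  moreover have "u - N (\<gamma> u - \<gamma> a) \<le> arrival_bound \<gamma> (\<gamma> a) u"
    using dN_ge[OF unit, of u "\<gamma> a - \<gamma> u"] u by (simp add: arrival_bound_def)
  ultimately show "u - a \<le> N (\<gamma> u - \<gamma> a)" by simp
qed

end

section \<open>Polygonal chains\<close>

lemma finite_polygonal_chain_refl: "finite_polygonal_chain N \<gamma> a a"
  unfolding finite_polygonal_chain_def by (intro exI[of _ 0] exI[of _ "\<lambda>_. a"]) simp

lemma finite_polygonal_chain_segment:
  "a < b \<Longrightarrow> unit_speed_segment N \<gamma> a b \<Longrightarrow> finite_polygonal_chain N \<gamma> a b"
  unfolding finite_polygonal_chain_def
  by (intro exI[of _ 1] exI[of _ "\<lambda>i. if i = 0 then a else b"]) simp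

lemma finite_polygonal_chain_trans:
  assumes "finite_polygonal_chain N \<gamma> a b" "finite_polygonal_chain N \<gamma> b c"
  shows "finite_polygonal_chain N \<gamma> a c"
proof -
  obtain k :: nat and \<sigma> where \<sigma>: "\<sigma> 0 = a" "\<sigma> k = b"
    "\<And>i. i < k \<Longrightarrow> \<sigma> i < \<sigma> (Suc i) \<and> unit_speed_segment N \<gamma> (\<sigma> i) (\<sigma> (Suc i))"
    using assms(1) unfolding finite_polygonal_chain_def by blast
  obtain l :: nat and \<tau> where \<tau>: "\<tau> 0 = b" "\<tau> l = c"
    "\<And>i. i < l \<Longrightarrow> \<tau> i < \<tau> (Suc i) \<and> unit_speed_segment N \<gamma> (\<tau> i) (\<tau> (Suc i))"
    using assms(2) unfolding finite_polygonal_chain_def by blast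
  define \<rho> where "\<rho> i = (if i \<le> k then \<sigma> i else \<tau> (i - k))" for i
  have "\<rho> i < \<rho> (Suc i) \<and> unit_speed_segment N \<gamma> (\<rho> i) (\<rho> (Suc i))" if "i < k + l" for i
  proof (cases "i < k")
    case True
    then show ?thesis using \<sigma>(3) by (simp add: \<rho>_def)
  next
    case False
    then have "\<rho> i = \<tau> (i - k)" "\<rho> (Suc i) = \<tau> (Suc (i - k))"
      using \<sigma>(2) \<tau>(1) by (auto simp: \<rho>_def Suc_diff_le le_antisym)
    then show ?thesis using \<tau>(3)[of "i - k"] that False by simp
  qed
  moreover have "\<rho> 0 = a" "\<rho> (k + l) = c" using \<sigma> \<tau> by (auto simp: \<rho>_def)
  ultimately show ?thesis unfolding finite_polygonal_chain_def by blast
qed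

context semi_dispersing_table
begin

lemma chain_in_interior:
  assumes traj: "billiard_trajectory N \<Omega> I \<gamma>" and cd: "{c..d} \<subseteq> interior I" "c \<le> d"
  shows "finite_polygonal_chain N \<gamma> c d"
  using cd(2)
proof (induction rule: Bolzano)
  case (trans p q r)
  then show ?case by (blast intro: finite_polygonal_chain_trans)
next
  case (local t)
  then have "t \<in> interior I" using cd by auto
  then obtain \<delta> v w where \<delta>: "deflects \<gamma> t \<delta> v w"
    using traj unfolding trajectory_iff_deflects by blast
  then have v: "\<delta> > 0" "N v = 1" "N w = 1" by (auto simp: deflects_def)
  have "finite_polygonal_chain N \<gamma> p q" if pq: "p \<le> t" "t \<le> q" "q - p < \<delta>" for p q
  proof (rule finite_polygonal_chain_trans)
    show "finite_polygonal_chain N \<gamma> p t"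
    proof (cases "p = t")
      case False
      have "\<gamma> u = \<gamma> p + (u - p) *\<^sub>R v" if "u \<in> {p..t}" for u
      proof -
        have up: "u \<in> {t - \<delta><..t}" "p \<in> {t - \<delta><..t}" using that pq by auto
        show ?thesis
          unfolding deflects_backward[OF \<delta> up(1)] deflects_backward[OF \<delta> up(2)]
          by (simp add: algebra_simps)
      qed
      then have "unit_speed_segment N \<gamma> p t" using v unfolding unit_speed_segment_def by blast
      then show ?thesis using False pq by (intro finite_polygonal_chain_segment) auto
    qed (simp add: finite_polygonal_chain_refl)
    show "finite_polygonal_chain N \<gamma> t q"
    proof (cases "q = t")
      case False
      have "\<gamma> u = \<gamma> t + (u - t) *\<^sub>R w" if "u \<in> {t..q}" for u
        using that pq by (intro deflects_forward[OF \<delta>]) auto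
      then have "unit_speed_segment N \<gamma> t q" using v unfolding unit_speed_segment_def by blast
      then show ?thesis using False pq by (intro finite_polygonal_chain_segment) auto
    qed (simp add: finite_polygonal_chain_refl)
  qed
  then show ?case using v(1) by blast
qed

lemma walls_near_time:
  assumes "continuous_on I \<gamma>" "t \<in> I"
  obtains e :: real where "e > 0"
    "\<And>u W. u \<in> I \<Longrightarrow> \<bar>u - t\<bar> < e \<Longrightarrow> W \<in> \<W> \<Longrightarrow> \<gamma> u \<in> W \<Longrightarrow> \<gamma> t \<in> W"
proof -
  obtain r where r: "r > 0" "\<And>x W. dist x (\<gamma> t) < r \<Longrightarrow> W \<in> \<W> \<Longrightarrow> x \<in> W \<Longrightarrow> \<gamma> t \<in> W"
    by (fact walls_near)
  obtain e where "e > 0" "\<And>u. u \<in> I \<Longrightarrow> dist u t < e \<Longrightarrow> dist (\<gamma> u) (\<gamma> t) < r"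
    using assms r(1) unfolding continuous_on_iff by metis
  then show ?thesis using r(2) by (intro that[of e]) (auto simp: dist_real_def)
qed

text \<open>
  Shortly before time \<open>b\<close>, only walls through \<open>\<gamma> b\<close> can be touched, so that \<open>\<gamma> b\<close> is a point common
  to all of them.
\<close>

lemma straight_before:
  assumes traj: "billiard_trajectory N \<Omega> I \<gamma>" and ab: "a \<in> I" "b \<in> I" "a < b"
  obtains s where "a < s" "s < b" "unit_speed_segment N \<gamma> s b"
proof -
  have I: "is_interval I" "continuous_on I \<gamma>"
    using traj unfolding trajectory_iff_deflects by auto
  obtain e where e: "e > 0"
    "\<And>u W. u \<in> I \<Longrightarrow> \<bar>u - b\<bar> < e \<Longrightarrow> W \<in> \<W> \<Longrightarrow> \<gamma> u \<in> W \<Longrightarrow> \<gamma> b \<in> W"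
    using walls_near_time[OF I(2) ab(2)] by blast
  define a' where "a' = max a (b - e)"
  have a': "a \<le> a'" "a' < b" using ab e by (auto simp: a'_def)
  have inI: "u \<in> I" if "u \<in> {a'..b}" for u
    using mem_is_interval_1_I[OF I(1) ab(1,2), of u] that a' by auto
  have "unit_speed_segment N \<gamma> ((a' + b) / 2) b"
  proof (rule straight_into_common_point[OF traj inI ab(2)])
    show "\<gamma> b \<in> W" if t: "t \<in> {a'<..<b}" and W: "W \<in> \<W>" "\<gamma> t \<in> W" for t W
      by (rule e(2)[OF inI _ W]) (use t in \<open>auto simp: a'_def\<close>)
  qed (use a' in auto)
  then show ?thesis using a' by (intro that[of "(a' + b) / 2"]) auto
qed

lemma straight_after:
  assumes traj: "billiard_trajectory N \<Omega> I \<gamma>" and ab: "a \<in> I" "b \<in> I" "a < b"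
  obtains s where "a < s" "s < b" "unit_speed_segment N \<gamma> a s"
proof -
  have I: "is_interval I" "continuous_on I \<gamma>"
    using traj unfolding trajectory_iff_deflects by auto
  obtain e where e: "e > 0"
    "\<And>u W. u \<in> I \<Longrightarrow> \<bar>u - a\<bar> < e \<Longrightarrow> W \<in> \<W> \<Longrightarrow> \<gamma> u \<in> W \<Longrightarrow> \<gamma> a \<in> W"
    using walls_near_time[OF I(2) ab(1)] by blast
  define b' where "b' = min b (a + e)"
  have b': "a < b'" "b' \<le> b" using ab e by (auto simp: b'_def)
  have inI: "u \<in> I" if "u \<in> {a..b'}" for u
    using mem_is_interval_1_I[OF I(1) ab(1,2), of u] that b' by auto
  have "unit_speed_segment N \<gamma> a ((a + b') / 2)"
  proof (rule straight_from_common_point[OF traj ab(1) inI])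
    show "\<gamma> a \<in> W" if t: "t \<in> {a<..<b'}" and W: "W \<in> \<W>" "\<gamma> t \<in> W" for t W
      by (rule e(2)[OF inI _ W]) (use t in \<open>auto simp: b'_def\<close>)
  qed (use b' in auto)
  then show ?thesis using b' by (intro that[of "(a + b') / 2"]) auto
qed

text \<open>
  Bounces could accumulate only at the two ends, and there the trajectory is straight.
\<close>

lemma trajectory_polygonal:
  assumes traj: "billiard_trajectory N \<Omega> {a..b} \<gamma>" and ab: "a \<le> b"
  shows "finite_polygonal_chain N \<gamma> a b"
proof (cases "a = b")
  case False
  with ab have lt: "a < b" by simp
  obtain s where s: "a < s" "s < b" "unit_speed_segment N \<gamma> a s"
    using straight_after[OF traj _ _ lt] lt by auto
  obtain t where t: "s < t" "t < b" "unit_speed_segment N \<gamma> t b"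
    using straight_before[OF traj, of s b] s by auto
  have "finite_polygonal_chain N \<gamma> s t"
    by (rule chain_in_interior[OF traj]) (use s t in auto)
  with s t show ?thesis
    by (meson finite_polygonal_chain_segment finite_polygonal_chain_trans)
qed (simp add: finite_polygonal_chain_refl)

section \<open>Extending trajectories\<close>

text \<open>
  A trajectory of unit speed is Lipschitz for the Euclidean norm, so it has a limit at the missing
  endpoint. No condition is imposed there, and the interior times are the same.
\<close>

lemma extend_to_closed_interval:
  assumes traj: "billiard_trajectory N \<Omega> {a..<b} \<gamma>" and ab: "a < b"
  obtains \<eta> where "billiard_trajectory N \<Omega> {a..b} \<eta>" "\<And>t. t \<in> {a..<b} \<Longrightarrow> \<eta> t = \<gamma> t"
proof -
  obtain m where m: "m > 0" "\<And>x. m * norm x \<le> N x" by (fact norm_bound)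
  have lip: "dist (\<gamma> y) (\<gamma> x) \<le> (y - x) / m" if "x \<in> {a..<b}" "y \<in> {a..<b}" "x \<le> y" for x y
    using trajectory_1_lipschitz[OF traj that] m(2)[of "\<gamma> y - \<gamma> x"] m(1)
    by (simp add: dist_norm field_simps)
  have "uniformly_continuous_on {a..<b} \<gamma>"
    unfolding uniformly_continuous_on_def
  proof (intro allI impI exI conjI ballI)
    fix e :: real and x y assume e: "e > 0" "x \<in> {a..<b}" "y \<in> {a..<b}" "dist y x < e * m"
    then have "\<bar>y - x\<bar> / m < e" using m(1) by (simp add: dist_real_def field_simps)
    moreover have "dist (\<gamma> y) (\<gamma> x) \<le> \<bar>y - x\<bar> / m"
      using lip[of x y] lip[of y x] e by (cases "x \<le> y") (auto simp: dist_commute)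
    ultimately show "dist (\<gamma> y) (\<gamma> x) < e" by simp
  qed (use m in auto)
  then obtain \<eta> where \<eta>: "uniformly_continuous_on (closure {a..<b}) \<eta>"
    "\<And>t. t \<in> {a..<b} \<Longrightarrow> \<gamma> t = \<eta> t"
    by (rule uniformly_continuous_on_extension_on_closure) (rule that; assumption)
  have cl: "closure {a..<b} = {a..b}" using ab by simp
  have cont: "continuous_on {a..b} \<eta>"
    using uniformly_continuous_imp_continuous[OF \<eta>(1)] cl by simp
  have T: "\<gamma> ` {a..<b} \<subseteq> closure \<Omega>"
    "\<And>t. t \<in> interior {a..<b} \<Longrightarrow> \<exists>\<delta> v w. {t - \<delta><..<t + \<delta>} \<subseteq> {a..<b} \<and> deflects \<gamma> t \<delta> v w"
    using traj unfolding trajectory_iff_deflects by auto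
  have "\<eta> ` closure {a..<b} \<subseteq> closure \<Omega>"
    by (rule image_closure_subset) (use cont cl T(1) \<eta>(2) in auto)
  moreover have "\<exists>\<delta> v w. {t - \<delta><..<t + \<delta>} \<subseteq> {a..b} \<and> deflects \<eta> t \<delta> v w"
    if "t \<in> interior {a..b}" for t
  proof -
    have "t \<in> interior {a..<b}" using that by simp
    from T(2)[OF this] obtain \<delta> v w where
      D: "{t - \<delta><..<t + \<delta>} \<subseteq> {a..<b}" "deflects \<gamma> t \<delta> v w" by blast
    have "deflects \<eta> t \<delta> v w"
    proof (rule deflects_cong[OF D(2)])
      show "\<eta> u = \<gamma> u" if "u \<in> {t - \<delta><..<t + \<delta>}" for u using that D(1) \<eta>(2) by auto
    qed (use D(2) in \<open>auto simp: deflects_def\<close>)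
    moreover have "{t - \<delta><..<t + \<delta>} \<subseteq> {a..b}" using D(1) by fastforce
    ultimately show ?thesis by blast
  qed
  ultimately have "billiard_trajectory N \<Omega> {a..b} \<eta>"
    unfolding trajectory_iff_deflects using cont cl ab by (simp add: is_interval_cc)
  then show ?thesis using that \<eta>(2) by metis
qed

lemma extend_beyond:
  assumes traj: "billiard_trajectory N \<Omega> {a..b} \<gamma>" and ab: "a \<le> b"
    and p: "\<gamma> b \<in> \<Omega> \<or> smooth_boundary_point \<Omega> (\<gamma> b)"
  obtains c \<eta> where "b < c" "billiard_trajectory N \<Omega> {a..c} \<eta>" "\<And>t. t \<in> {a..b} \<Longrightarrow> \<eta> t = \<gamma> t"
proof -
  have T: "continuous_on {a..b} \<gamma>" "\<gamma> ` {a..b} \<subseteq> closure \<Omega>"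
    "\<And>t. t \<in> interior {a..b} \<Longrightarrow> \<exists>\<delta> v w. {t - \<delta><..<t + \<delta>} \<subseteq> {a..b} \<and> deflects \<gamma> t \<delta> v w"
    using traj unfolding trajectory_iff_deflects by auto
  obtain v e where v: "N v = 1" "e > 0"
    and arrive: "\<And>s. s \<in> {0<..<e} \<Longrightarrow> \<gamma> b - s *\<^sub>R v \<in> closure \<Omega>"
    and last: "a < b \<Longrightarrow> e \<le> b - a \<and> (\<forall>s\<in>{0..<e}. \<gamma> (b - s) = \<gamma> b - s *\<^sub>R v)"
  proof (cases "a = b")
    \<comment> \<open>A single instant has no arrival velocity; any admissible one will do.\<close>
    case True
    with arrival_exists[OF p] that show ?thesis by blast
  next
    case False
    with ab have lt: "a < b" by simp
    obtain s where s: "a < s" "s < b" "unit_speed_segment N \<gamma> s b"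
      using straight_before[OF traj _ _ lt] lt by auto
    then obtain v where v: "N v = 1" "\<And>u. u \<in> {s..b} \<Longrightarrow> \<gamma> u = \<gamma> s + (u - s) *\<^sub>R v"
      unfolding unit_speed_segment_def by blast
    have b: "\<gamma> b = \<gamma> s + (b - s) *\<^sub>R v" using s by (intro v(2)) auto
    have arrival: "\<gamma> (b - d) = \<gamma> b - d *\<^sub>R v" if "d \<in> {0..<b - s}" for d
    proof -
      have "b - d \<in> {s..b}" using that by auto
      from v(2)[OF this] show ?thesis unfolding b by (simp add: algebra_simps)
    qed
    show ?thesis
    proof (rule that[of v "b - s"])
      show "\<gamma> b - d *\<^sub>R v \<in> closure \<Omega>" if "d \<in> {0<..<b - s}" for d
      proof -
        have "d \<in> {0..<b - s}" "b - d \<in> {a..b}" using that s by auto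
        then show ?thesis using arrival[of d] T(2) by (metis image_subset_iff)
      qed
    qed (use v(1) s(1,2) arrival in auto)
  qed
  obtain w \<delta> where w: "N w = 1" "\<delta> > 0" and leave: "\<And>s. s \<in> {0..\<delta>} \<Longrightarrow> \<gamma> b + s *\<^sub>R w \<in> closure \<Omega>"
    and refl: "w = v \<or> smooth_boundary_point \<Omega> (\<gamma> b) \<and>
       (\<forall>x\<in>tangent_vectors (frontier \<Omega>) (\<gamma> b). dN v x = dN w x)"
    using continuation[OF p v arrive] by blast
  define \<eta> where "\<eta> t = (if t \<le> b then \<gamma> t else \<gamma> b + (t - b) *\<^sub>R w)" for t
  have old: "\<eta> t = \<gamma> t" if "t \<le> b" for t using that by (simp add: \<eta>_def)
  have new: "\<eta> t = \<gamma> b + (t - b) *\<^sub>R w" if "t \<ge> b" for t using that by (auto simp: \<eta>_def)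
  let ?c = "b + \<delta>"
  have "billiard_trajectory N \<Omega> {a..?c} \<eta>"
    unfolding trajectory_iff_deflects
  proof (intro conjI ballI)
    have "{x \<in> {a..?c}. x \<le> b} = {a..b}" using w by auto
    then show "continuous_on {a..?c} \<eta>"
      unfolding \<eta>_def
      by (intro continuous_on_cases_le continuous_intros) (auto simp: T(1))
    show "\<eta> ` {a..?c} \<subseteq> closure \<Omega>"
    proof
      fix x assume "x \<in> \<eta> ` {a..?c}"
      then obtain t where t: "t \<in> {a..?c}" "x = \<eta> t" by auto
      show "x \<in> closure \<Omega>"
      proof (cases "t \<le> b")
        case True
        then show ?thesis using t T(2) old[of t] by auto
      next
        case False
        then show ?thesis using t new[of t] leave[of "t - b"] by auto
      qed
    qed
    fix t assume "t \<in> interior {a..?c}"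
    then have t: "a < t" "t < ?c" by auto
    consider "t < b" | "t = b" | "t > b" by linarith
    then show "\<exists>\<delta>' v w. {t - \<delta>'<..<t + \<delta>'} \<subseteq> {a..?c} \<and> deflects \<eta> t \<delta>' v w"
    proof cases
      case 1
      with t have "t \<in> interior {a..b}" by simp
      from T(3)[OF this] obtain d v' w' where
        D: "{t - d<..<t + d} \<subseteq> {a..b}" "deflects \<gamma> t d v' w'" by blast
      have "d > 0" using D(2) by (simp add: deflects_def)
      let ?d = "min d (b - t)"
      have "deflects \<eta> t ?d v' w'"
        by (rule deflects_cong[OF D(2)]) (use \<open>d > 0\<close> 1 in \<open>auto intro: old\<close>)
      moreover have "{t - ?d<..<t + ?d} \<subseteq> {t - d<..<t + d}" by auto
      then have "{t - ?d<..<t + ?d} \<subseteq> {a..?c}" using D(1) w(2) by fastforce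
      ultimately show ?thesis by blast
    next
      case 2
      then have lt: "a < b" using t by simp
      let ?d = "min e \<delta>"
      have "\<eta> (b - s) = \<eta> b - s *\<^sub>R v" "\<eta> (b + s) = \<eta> b + s *\<^sub>R w" if "s \<in> {0..<?d}" for s
        using that last[OF lt] old[of b] old[of "b - s"] new[of "b + s"] by auto
      then have "deflects \<eta> t ?d v w"
        using v w refl 2 old[of b] unfolding deflects_def by auto
      moreover have "{t - ?d<..<t + ?d} \<subseteq> {a..?c}" using last[OF lt] 2 by auto
      ultimately show ?thesis by blast
    next
      case 3
      let ?d = "min (t - b) (?c - t)"
      have "\<eta> (t - s) = \<eta> t - s *\<^sub>R w" "\<eta> (t + s) = \<eta> t + s *\<^sub>R w" if "s \<in> {0..<?d}" for s
      proof -
        have ge: "t - s \<ge> b" "t \<ge> b" "t + s \<ge> b" using that 3 by auto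
        show "\<eta> (t - s) = \<eta> t - s *\<^sub>R w" "\<eta> (t + s) = \<eta> t + s *\<^sub>R w"
          unfolding new[OF ge(1)] new[OF ge(2)] new[OF ge(3)] by (simp_all add: algebra_simps)
      qed
      then have "deflects \<eta> t ?d w w"
        using w 3 t unfolding deflects_def by auto
      moreover have "{t - ?d<..<t + ?d} \<subseteq> {a..?c}" using 3 ab by auto
      ultimately show ?thesis by blast
    qed
  qed (use ab w in \<open>auto simp: is_interval_cc\<close>)
  then show ?thesis using w(2) old by (intro that[of ?c \<eta>]) auto
qed

end

section \<open>Maximal trajectories\<close>

lemma interval_with_left_endpoint:
  assumes I: "is_interval I" and a: "left_endpoint_in a I"
  obtains "I = {a..}" | b where "a < b" "I = {a..<b}" | b where "a \<le> b" "I = {a..b}"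
proof -
  have a: "a \<in> I" "\<And>t. t \<in> I \<Longrightarrow> a \<le> t" using a by (auto simp: left_endpoint_in_def)
  have upto: "t \<in> I" if "u \<in> I" "a \<le> t" "t \<le> u" for t u
    using mem_is_interval_1_I[OF I a(1) that(1)] that by simp
  show ?thesis
  proof (cases "bdd_above I")
    case False
    have "t \<in> I" if "a \<le> t" for t
    proof -
      obtain u where "u \<in> I" "t < u" using False unfolding bdd_above_def by (meson not_le)
      then show ?thesis using upto[of u t] that by simp
    qed
    then show ?thesis using a by (intro that(1)) auto
  next
    case True
    define b where "b = Sup I"
    have b: "t \<le> b" if "t \<in> I" for t using that True by (simp add: b_def cSup_upper)
    have below: "t \<in> I" if t: "a \<le> t" "t < b" for t
    proof -
      obtain u where "u \<in> I" "t < u" using t a(1) less_cSup_iff[of I t] True by (auto simp: b_def)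
      then show ?thesis using upto[of u t] t by simp
    qed
    show ?thesis
    proof (cases "b \<in> I")
      case True
      have "{a..b} \<subseteq> I" using upto[OF True] by auto
      moreover have "I \<subseteq> {a..b}" using a(2) b by auto
      ultimately show ?thesis using b[OF a(1)] by (intro that(3)[of b]) auto
    next
      case False
      then have b': "t < b" if "t \<in> I" for t using b[OF that] that by (cases "t = b") auto
      have "{a..<b} \<subseteq> I" using below by auto
      moreover have "I \<subseteq> {a..<b}" using a(2) b' by auto
      ultimately show ?thesis using b'[OF a(1)] by (intro that(2)[of b]) auto
    qed
  qed
qed

lemma trajectory_length_unbounded: "trajectory_length {a..} = \<infinity>"
proof -
  have "ennreal (real n) \<le> emeasure lborel {a..}" for n
  proof -
    have "ennreal (real n) = emeasure lborel {a..a + real n}" by simp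
    also have "\<dots> \<le> emeasure lborel {a..}" by (intro emeasure_mono) auto
    finally show ?thesis .
  qed
  then have "top \<le> emeasure lborel {a..}"
    by (metis ennreal_of_nat_eq_real_of_nat ennreal_Ex_less_of_nat linorder_not_le)
  then show ?thesis by (simp add: trajectory_length_def top_unique)
qed

theorem corollary2p8:
  fixes N :: "'a::euclidean_space \<Rightarrow> real"
    and \<Omega> :: "'a set" and \<gamma> :: "real \<Rightarrow> 'a" and I :: "real set" and a :: real
  assumes "minkowski_billiard N \<Omega>"
    and "semi_dispersing \<Omega>"
    and "maximal_forward_trajectory N \<Omega> a I \<gamma>"
  shows "trajectory_length I = \<infinity> \<or>
    (\<exists>b. I = {a..b} \<and> finite_polygonal_chain N \<gamma> a b \<and>
         \<gamma> b \<in> frontier \<Omega> \<and> \<not> smooth_boundary_point \<Omega> (\<gamma> b))"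
proof -
  have N: "minkowski_norm N" using assms(1) by (simp add: minkowski_billiard_def)
  then obtain N' :: "'a \<Rightarrow> 'a \<Rightarrow>\<^sub>L real"
    where "\<forall>x\<in>- {0}. (N has_derivative blinfun_apply (N' x)) (at x)"
    unfolding minkowski_norm_def C1_on_def by blast
  then have N': "\<And>x. x \<noteq> 0 \<Longrightarrow> (N has_derivative blinfun_apply (N' x)) (at x)"
    by simp
  obtain m :: nat and W where W: "\<And>i. i \<in> {1..m} \<Longrightarrow> wall (W i)" "\<Omega> = UNIV - (\<Union>i\<in>{1..m}. W i)"
    using assms(2) unfolding semi_dispersing_def by blast
  interpret semi_dispersing_table N "\<lambda>x. blinfun_apply (N' x)" "W ` {1..m}" \<Omega>
    using N N' W by unfold_locales auto
  have traj: "billiard_trajectory N \<Omega> I \<gamma>" and left: "left_endpoint_in a I"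
    and maximal: "\<And>J \<eta>. billiard_trajectory N \<Omega> J \<eta> \<Longrightarrow> left_endpoint_in a J \<Longrightarrow> I \<subset> J \<Longrightarrow>
              (\<And>t. t \<in> I \<Longrightarrow> \<eta> t = \<gamma> t) \<Longrightarrow> False"
    using assms(3) unfolding maximal_forward_trajectory_def by blast+
  have "is_interval I" using traj unfolding billiard_trajectory_def by simp
  from this left show ?thesis
  proof (cases rule: interval_with_left_endpoint)
    case 1
    then show ?thesis by (simp add: trajectory_length_unbounded)
  next
    case (2 b)
    obtain \<eta> where \<eta>: "billiard_trajectory N \<Omega> {a..b} \<eta>" "\<And>t. t \<in> {a..<b} \<Longrightarrow> \<eta> t = \<gamma> t"
      using extend_to_closed_interval[OF traj[unfolded 2(2)] 2(1)] by blast
    have False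
      by (rule maximal[OF \<eta>(1)]) (use 2 \<eta>(2) in \<open>auto simp: left_endpoint_in_def\<close>)
    then show ?thesis ..
  next
    case (3 b)
    note traj' = traj[unfolded 3(2)]
    have stuck: "\<not> (\<gamma> b \<in> \<Omega> \<or> smooth_boundary_point \<Omega> (\<gamma> b))"
    proof
      assume "\<gamma> b \<in> \<Omega> \<or> smooth_boundary_point \<Omega> (\<gamma> b)"
      then obtain c \<eta> where c: "b < c" and \<eta>: "billiard_trajectory N \<Omega> {a..c} \<eta>"
        "\<And>t. t \<in> {a..b} \<Longrightarrow> \<eta> t = \<gamma> t"
        using extend_beyond[OF traj' 3(1)] by blast
      show False
        by (rule maximal[OF \<eta>(1)]) (use 3 c \<eta>(2) in \<open>auto simp: left_endpoint_in_def\<close>)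
    qed
    have "\<gamma> b \<in> closure \<Omega>" using traj' 3(1) unfolding billiard_trajectory_def by auto
    with stuck have "\<gamma> b \<in> frontier \<Omega>" using open_table by (simp add: frontier_def interior_open)
    with stuck trajectory_polygonal[OF traj' 3(1)] 3(2) show ?thesis by blast
  qed
qed

end
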